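(* Let $\Omega\subset\mathbb C^n$ be a bounded pseudoconvex domain with $0\in\Omega$. Then among the hermitian ellipsoids $E\in\mathbb E_0$ with $E\subset\Omega$ there is at least one that has maximal volume. Moreover, for a positive definite hermitian form $h$ on $\mathbb C^n$ with $E_h\subset\Omega$, the ellipsoid $E_h$ has maximal volume among all $E\in\mathbb E_0$ contained in $\Omega$ if and only if there is a Borel measure $\mu$ on $\partial\Omega\cap\partial E_h$ such that for every $\mathbb C$-linear operator $T:\mathbb C^n\to\mathbb C^n$ $$\int_{\partial\Omega\cap\partial E_h}h(Tz,z)\,d\mu(z)=\operatorname{tr} T.$$
   Context: A domain is a connected open set. An open set $\Omega\subset\mathbb C^n$ is pseudoconvex if it admits a continuous plurisubharmonic exhaustion function $u:\Omega\to\mathbb R$, i.e. one for which $\{\zeta\in\Omega:u(\zeta)\le c\}$ is compact for every $c\in\mathbb R$. A hermitian ellipsoid is the image of the open unit ball of $\mathbb C^n$ under an invertible $\mathbb C$-linear transformation (so it is centered at $0$); $\mathbb E_0$ denotes the set of all hermitian ellipsoids in $\mathbb C^n$. It is in bijection with the positive definite hermitian forms $h:\mathbb C^n\times\mathbb C^n\to\mathbb C$ (linear in the first, conjugate linear in the second variable), the ellipsoid corresponding to $h$ being $E_h=\{z\in\mathbb C^n:h(z,z)<1\}$. Volume is Lebesgue measure on $\mathbb C^n\cong\mathbb R^{2n}$. Measures are nonnegative. *)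

theory Defs
  imports "HOL-Analysis.Analysis"
begin

definition upper_semicontinuous_on :: "'a::topological_space set \<Rightarrow> ('a \<Rightarrow> real) \<Rightarrow> bool" where
  "upper_semicontinuous_on S f \<longleftrightarrow> (\<forall>c. openin (top_of_set S) {x \<in> S. f x < c})"

text \<open>Only real-valued (nowhere \<open>-\<infinity>\<close>) functions are considered. For these the sub-mean-value
  inequality forces the circle means to be finite, so integrability is part of the definition
  rather than an extra restriction.\<close>

definition subharmonic_on :: "complex set \<Rightarrow> (complex \<Rightarrow> real) \<Rightarrow> bool" where
  "subharmonic_on S f \<longleftrightarrow>
     upper_semicontinuous_on S f \<and>
     (\<forall>a r. 0 < r \<longrightarrow> cball a r \<subseteq> S \<longrightarrow>
        (\<lambda>t. f (a + of_real r * cis t)) absolutely_integrable_on {0..2*pi} \<and>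
        f a \<le> 1 / (2*pi) * integral {0..2*pi} (\<lambda>t. f (a + of_real r * cis t)))"

definition plurisubharmonic_on :: "(complex ^ 'n) set \<Rightarrow> (complex ^ 'n \<Rightarrow> real) \<Rightarrow> bool" where
  "plurisubharmonic_on S u \<longleftrightarrow>
     upper_semicontinuous_on S u \<and>
     (\<forall>z w. subharmonic_on {\<tau>. z + \<tau> *s w \<in> S} (\<lambda>\<tau>. u (z + \<tau> *s w)))"

definition pseudoconvex :: "(complex ^ 'n) set \<Rightarrow> bool" where
  "pseudoconvex \<Omega> \<longleftrightarrow> open \<Omega> \<and>
     (\<exists>u. continuous_on \<Omega> u \<and> plurisubharmonic_on \<Omega> u \<and>
          (\<forall>c. compact {\<zeta> \<in> \<Omega>. u \<zeta> \<le> c}))"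

text \<open>The library's \<^const>\<open>linear\<close> is \<open>\<real>\<close>-linearity, so \<open>\<complex>\<close>-linearity is stated with
  respect to the complex scalar multiplication \<open>(*s)\<close>.\<close>

abbreviation clinear :: "(complex ^ 'n \<Rightarrow> complex ^ 'm) \<Rightarrow> bool" where
  "clinear T \<equiv> Vector_Spaces.linear (*s) (*s) T"

definition hermitian_ellipsoids :: "(complex ^ 'n) set set" where
  "hermitian_ellipsoids = {T ` ball 0 1 | T :: complex ^ 'n \<Rightarrow> complex ^ 'n. clinear T \<and> bij T}"

text \<open>Conjugate linearity in the second variable follows from linearity in the first and
  hermitian symmetry, which also makes \<open>h z z\<close> real.\<close>

definition pos_def_hermitian_form :: "(complex ^ 'n \<Rightarrow> complex ^ 'n \<Rightarrow> complex) \<Rightarrow> bool" where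
  "pos_def_hermitian_form h \<longleftrightarrow>
     (\<forall>w. Vector_Spaces.linear (*s) (*) (\<lambda>z. h z w)) \<and>
     (\<forall>z w. h w z = cnj (h z w)) \<and>
     (\<forall>z. z \<noteq> 0 \<longrightarrow> 0 < Re (h z z))"

definition ellipsoid_of :: "(complex ^ 'n \<Rightarrow> complex ^ 'n \<Rightarrow> complex) \<Rightarrow> (complex ^ 'n) set" where
  "ellipsoid_of h = {z. Re (h z z) < 1}"

definition max_volume_ellipsoid :: "(complex ^ 'n) set \<Rightarrow> (complex ^ 'n) set \<Rightarrow> bool" where
  "max_volume_ellipsoid \<Omega> E \<longleftrightarrow>
     E \<in> hermitian_ellipsoids \<and> E \<subseteq> \<Omega> \<and>
     (\<forall>E' \<in> hermitian_ellipsoids. E' \<subseteq> \<Omega> \<longrightarrow> measure lebesgue E' \<le> measure lebesgue E)"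

definition ctrace :: "(complex ^ 'n \<Rightarrow> complex ^ 'n) \<Rightarrow> complex" where
  "ctrace T = trace (matrix T)"

end

theory Submission
  imports Defs
begin

text \<open>Ellipsoids are the sets \<open>M B\<close> with \<open>M\<close> an invertible matrix and \<open>B\<close> the unit ball, and the volume of
  \<open>M B\<close> is proportional to \<open>\<bar>det M\<bar>\<^sup>2\<close>. A maximum exists because the matrices with \<open>M B \<subseteq> \<Omega>\<close> are bounded and
  every invertible limit of such matrices is again one of them.

  In coordinates with \<open>E\<^sub>h = B\<close>, the identity \<open>\<integral> h(Tz, z) d\<mu> = tr T\<close> says that the identity matrix is a mean
  of the matrices \<open>z z\<^sup>*\<close> with \<open>z\<close> a contact point. If it does not lie in the convex cone of these matrices, a
  separating hyperplane gives a hermitian matrix \<open>H\<close> with \<open>tr H > 0\<close> and \<open>\<langle>Hz, z\<rangle> < 0\<close> at all contact points,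
  and \<open>(1 + t H) B\<close> is a larger ellipsoid inside \<open>\<Omega>\<close> for small \<open>t > 0\<close>.

  Conversely, let \<open>E' \<subseteq> \<Omega>\<close> be larger than \<open>B\<close>. After a unitary change of coordinates \<open>E' = D B\<close> with
  \<open>D = diag (exp l)\<close> and \<open>tr l > 0\<close>, so the identity yields a contact point \<open>z\<close> with \<open>\<langle>l z, z\<rangle> > 0\<close>, which lies in
  \<open>D\<^sup>t B\<close> for small \<open>t > 0\<close>. This contradicts pseudoconvexity: the ellipsoids \<open>D\<^sup>\<zeta> B\<close> form a holomorphic family
  over the strip \<open>0 \<le> Re \<zeta> \<le> 1\<close> whose boundary values \<open>B\<close> and \<open>E'\<close> lie in \<open>\<Omega>\<close>, hence so do all \<open>D\<^sup>t B\<close>.\<close>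

section \<open>Volume under linear maps\<close>

text \<open>With \<open>\<beta>\<close> a bijection of the standard bases this merely relabels real
  coordinates. It transports volume questions between \<open>complex ^ 'n\<close> and
  \<open>real ^ ('n bit0)\<close>.\<close>

definition basis_map :: "('a \<Rightarrow> 'b) \<Rightarrow> 'a::euclidean_space \<Rightarrow> 'b::euclidean_space" where
  "basis_map \<beta> x = (\<Sum>b\<in>Basis. (x \<bullet> b) *\<^sub>R \<beta> b)"

lemma linear_basis_map: "linear (basis_map \<beta>)"
  unfolding basis_map_def
  by (intro linearI) (auto simp: inner_simps scaleR_add_left sum.distrib scaleR_sum_right)

lemma basis_map_inner:
  fixes \<beta> :: "'a::euclidean_space \<Rightarrow> 'b::euclidean_space"
  assumes "bij_betw \<beta> Basis Basis" "b \<in> Basis"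
  shows "basis_map \<beta> x \<bullet> \<beta> b = x \<bullet> b"
proof -
  have "basis_map \<beta> x \<bullet> \<beta> b = (\<Sum>c\<in>Basis. (x \<bullet> c) * (if c = b then 1 else 0))"
    unfolding basis_map_def inner_sum_left
  proof (intro sum.cong refl)
    fix c :: 'a assume c: "c \<in> Basis"
    have "\<beta> c \<in> Basis" "\<beta> b \<in> Basis" "\<beta> c = \<beta> b \<longleftrightarrow> c = b"
      using assms c by (auto simp: bij_betw_def inj_on_def)
    then show "(x \<bullet> c) *\<^sub>R \<beta> c \<bullet> \<beta> b = x \<bullet> c * (if c = b then 1 else 0)"
      by (simp add: inner_Basis)
  qed
  also have "\<dots> = x \<bullet> b" using assms(2) by (simp add: if_distrib sum.delta cong: if_cong)
  finally show ?thesis .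
qed

text \<open>\<open>lborel\<close> is determined by its values on boxes, and the preimage of a box is
  a box with the same side lengths in another order.\<close>

lemma distr_basis_map:
  fixes \<beta> :: "'a::euclidean_space \<Rightarrow> 'b::euclidean_space"
  assumes \<beta>: "bij_betw \<beta> Basis Basis"
  shows "distr lborel borel (basis_map \<beta>) = lborel"
proof (rule lborel_eqI[symmetric])
  fix l u :: 'b assume le: "\<And>b. b \<in> Basis \<Longrightarrow> l \<bullet> b \<le> u \<bullet> b"
  have im: "\<beta> ` Basis = Basis" and inj: "inj_on \<beta> Basis"
    using \<beta> by (auto simp: bij_betw_def)
  have m[measurable]: "basis_map \<beta> \<in> borel_measurable borel"
    by (intro borel_measurable_continuous_onI linear_continuous_on linear_basis_map linear_linear[THEN iffD1])
       (simp add: linear_basis_map linear_conv_bounded_linear[symmetric])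
  define l' u' where "l' = (\<Sum>b\<in>Basis. (l \<bullet> \<beta> b) *\<^sub>R b)" and "u' = (\<Sum>b\<in>Basis. (u \<bullet> \<beta> b) *\<^sub>R b)"
  have l': "l' \<bullet> b = l \<bullet> \<beta> b" "u' \<bullet> b = u \<bullet> \<beta> b" if "b \<in> Basis" for b
    using that by (auto simp: l'_def u'_def)
  have "basis_map \<beta> -` box l u = box l' u'"
    unfolding box_def using im l' basis_map_inner[OF \<beta>] by (auto simp: im[symmetric] simp del: im)
  moreover have "(\<Prod>b\<in>Basis. (u' - l') \<bullet> b) = (\<Prod>b\<in>Basis. (u - l) \<bullet> b)"
    unfolding im[symmetric] prod.reindex[OF inj] by (simp add: inner_simps l')
  moreover have "l' \<bullet> b \<le> u' \<bullet> b" if "b \<in> Basis" for b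
    using le im l' that by (metis imageI)
  ultimately show "emeasure (distr lborel borel (basis_map \<beta>)) (box l u) = (\<Prod>b\<in>Basis. (u - l) \<bullet> b)"
    by (simp add: emeasure_distr emeasure_lborel_box)
qed simp

lemma basis_map_inverse:
  fixes \<beta> :: "'a::euclidean_space \<Rightarrow> 'b::euclidean_space"
  assumes \<beta>: "bij_betw \<beta> Basis Basis"
  shows "basis_map (inv_into Basis \<beta>) (basis_map \<beta> x) = x"
proof (rule euclidean_eqI)
  fix b :: 'a assume b: "b \<in> Basis"
  let ?g = "inv_into Basis \<beta>"
  have g: "bij_betw ?g Basis Basis" by (rule bij_betw_inv_into[OF \<beta>])
  have "?g (\<beta> b) = b" "\<beta> b \<in> Basis" using \<beta> b by (auto simp: bij_betw_def)
  then show "basis_map ?g (basis_map \<beta> x) \<bullet> b = x \<bullet> b"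
    using basis_map_inner[OF g, of "\<beta> b"] basis_map_inner[OF \<beta> b] by metis
qed

text \<open>The image under \<open>basis_map \<beta>\<close> is the preimage under the map of the
  inverse bijection, so \<open>distr_basis_map\<close> for the latter applies.\<close>

lemma measure_basis_map_image:
  fixes \<beta> :: "'a::euclidean_space \<Rightarrow> 'b::euclidean_space"
  assumes \<beta>: "bij_betw \<beta> Basis Basis" and S: "open S"
  shows "open (basis_map \<beta> ` S)" "measure lebesgue (basis_map \<beta> ` S) = measure lebesgue S"
proof -
  let ?g = "inv_into Basis \<beta>"
  have g: "bij_betw ?g Basis Basis" by (rule bij_betw_inv_into[OF \<beta>])
  have inv1: "basis_map ?g (basis_map \<beta> x) = x" for x by (rule basis_map_inverse[OF \<beta>])
  have inj: "inj (basis_map ?g :: 'b \<Rightarrow> 'a)"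
  proof (rule injI)
    fix x y :: 'b assume eq: "basis_map ?g x = basis_map ?g y"
    show "x = y"
    proof (rule euclidean_eqI)
      fix b :: 'b assume "b \<in> Basis"
      then show "x \<bullet> b = y \<bullet> b" using basis_map_inner[OF g] eq by metis
    qed
  qed
  have inv2: "basis_map \<beta> (basis_map ?g x) = x" for x using inv1 inj by (metis injD)
  have im: "basis_map \<beta> ` S = basis_map ?g -` S"
  proof (intro equalityI subsetI)
    fix y assume "y \<in> basis_map ?g -` S"
    then show "y \<in> basis_map \<beta> ` S" using inv2[of y] by (metis imageI vimageE)
  qed (auto simp: inv1)
  have c: "continuous_on UNIV (basis_map ?g :: 'b \<Rightarrow> 'a)"
    by (simp add: linear_basis_map linear_conv_bounded_linear[symmetric] linear_continuous_on)
  show o: "open (basis_map \<beta> ` S)"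
    unfolding im by (rule open_vimage[OF S c])
  have "measure lborel S = measure (distr lborel borel (basis_map ?g)) S"
    by (simp add: distr_basis_map[OF g])
  also have "\<dots> = measure lborel (basis_map \<beta> ` S)"
    using S c by (subst measure_distr) (auto simp: im borel_measurable_continuous_onI)
  finally show "measure lebesgue (basis_map \<beta> ` S) = measure lebesgue S"
    using o S by (simp add: measure_def)
qed

lemma open_linear_bij_image:
  fixes f :: "'a::euclidean_space \<Rightarrow> 'a"
  assumes "linear f" "inj f" "open S"
  shows "open (f ` S)"
  using assms linear_inj_imp_surj open_surjective_linear_image by blast

text \<open>The change of variables theorem of the library is stated for \<open>real ^ 'm\<close> with a well-ordered
  index type only. The type \<open>'n bit0\<close> is such an index type and has twice as many elements as \<open>'n\<close>.\<close>

lemma measure_linear_image_factor: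
  fixes f :: "complex ^ 'n \<Rightarrow> complex ^ 'n"
  assumes f: "linear f" "inj f"
  obtains k where "k \<ge> 0" "\<And>S. \<lbrakk>open S; bounded S\<rbrakk> \<Longrightarrow> measure lebesgue (f ` S) = k * measure lebesgue S"
proof -
  have "card (Basis :: (complex ^ 'n) set) = card (Basis :: (real ^ ('n bit0)) set)"
    by simp
  then obtain \<beta> :: "complex ^ 'n \<Rightarrow> real ^ ('n bit0)" where \<beta>: "bij_betw \<beta> Basis Basis"
    using finite_same_card_bij[OF finite_Basis finite_Basis] by metis
  let ?\<phi> = "basis_map \<beta>" and ?\<psi> = "basis_map (inv_into Basis \<beta>)"
  have g: "bij_betw (inv_into Basis \<beta>) Basis Basis" by (rule bij_betw_inv_into[OF \<beta>])
  define h where "h = ?\<phi> \<circ> f \<circ> ?\<psi>"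
  have h: "linear h"
    unfolding h_def by (intro linear_compose linear_basis_map f)
  have inv: "?\<psi> (?\<phi> x) = x" for x by (rule basis_map_inverse[OF \<beta>])
  show thesis
  proof (rule that[of "\<bar>det (matrix h)\<bar>"])
    fix S :: "(complex ^ 'n) set" assume S: "open S" "bounded S"
    have "h ` (?\<phi> ` S) = ?\<phi> ` f ` S"
      by (auto simp: h_def inv image_image)
    then have "measure lebesgue (f ` S) = measure lebesgue (h ` (?\<phi> ` S))"
      using measure_basis_map_image(2)[OF \<beta> open_linear_bij_image[OF f S(1)]] by simp
    also have "\<dots> = \<bar>det (matrix h)\<bar> * measure lebesgue (?\<phi> ` S)"
    proof (rule measure_linear_image[OF h])
      have "bounded (?\<phi> ` S)"
        using S by (simp add: bounded_linear_image linear_basis_map linear_conv_bounded_linear[symmetric])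
      then show "?\<phi> ` S \<in> lmeasurable"
        using measure_basis_map_image(1)[OF \<beta> S(1)] by (simp add: lmeasurable_open)
    qed
    finally show "measure lebesgue (f ` S) = \<bar>det (matrix h)\<bar> * measure lebesgue S"
      by (simp add: measure_basis_map_image[OF \<beta> S(1)])
  qed simp
qed

section \<open>Unitary diagonalization\<close>

definition adjm :: "complex ^ 'n ^ 'm \<Rightarrow> complex ^ 'm ^ 'n" where
  "adjm A = (\<chi> i j. cnj (A $ j $ i))"

definition cdot :: "complex ^ 'n \<Rightarrow> complex ^ 'n \<Rightarrow> complex" where
  "cdot v w = (\<Sum>i\<in>UNIV. v $ i * cnj (w $ i))"

definition diagm :: "('n \<Rightarrow> real) \<Rightarrow> complex ^ 'n ^ 'n" where
  "diagm d = (\<chi> i j. if i = j then of_real (d i) else 0)"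

definition unitary :: "complex ^ 'n ^ 'n \<Rightarrow> bool" where
  "unitary U \<longleftrightarrow> adjm U ** U = mat 1"

lemma cdot_add_left: "cdot (u + v) w = cdot u w + cdot v w"
  by (simp add: cdot_def algebra_simps sum.distrib)

lemma cdot_add_right: "cdot w (u + v) = cdot w u + cdot w v"
  by (simp add: cdot_def algebra_simps sum.distrib)

lemma cdot_scale_left: "cdot (c *s u) w = c * cdot u w"
  by (simp add: cdot_def sum_distrib_left mult.assoc)

lemma cdot_scale_right: "cdot u (c *s w) = cnj c * cdot u w"
  by (simp add: cdot_def sum_distrib_left mult_ac)

lemma cdot_diff_left: "cdot (u - v) w = cdot u w - cdot v w"
  by (simp add: cdot_def algebra_simps sum_subtractf)

lemma cdot_diff_right: "cdot w (u - v) = cdot w u - cdot w v"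
  by (simp add: cdot_def algebra_simps sum_subtractf)

lemmas cdot_simps = cdot_diff_left cdot_diff_right cdot_add_left cdot_add_right cdot_scale_left cdot_scale_right

lemma cdot_commute: "cnj (cdot v w) = cdot w v"
  by (simp add: cdot_def cnj_sum mult.commute)

lemma cdot_self: "cdot v v = of_real ((norm v)\<^sup>2)"
  by (simp add: cdot_def norm_vec_def L2_set_def sum_nonneg complex_norm_square del: of_real_power)

lemma cdot_adjm: "cdot (A *v v) w = cdot v (adjm A *v w)"
proof -
  have "cdot (A *v v) w = (\<Sum>i\<in>UNIV. \<Sum>j\<in>UNIV. A $ i $ j * v $ j * cnj (w $ i))"
    by (simp add: cdot_def matrix_vector_mult_def sum_distrib_right)
  also have "\<dots> = (\<Sum>j\<in>UNIV. \<Sum>i\<in>UNIV. A $ i $ j * v $ j * cnj (w $ i))"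
    by (rule sum.swap)
  also have "\<dots> = cdot v (adjm A *v w)"
    by (simp add: cdot_def adjm_def matrix_vector_mult_def sum_distrib_left cnj_sum mult_ac)
  finally show ?thesis .
qed

lemma adjm_adjm [simp]: "adjm (adjm A) = A"
  by (simp add: adjm_def vec_eq_iff)

lemma adjm_mult: "adjm (A ** B) = adjm B ** adjm A"
  by (simp add: adjm_def matrix_matrix_mult_def vec_eq_iff cnj_sum mult.commute)

lemma adjm_diagm [simp]: "adjm (diagm d) = diagm d"
  by (auto simp: adjm_def diagm_def vec_eq_iff)

lemma diagm_vec [simp]: "(diagm d *v v) $ i = of_real (d i) * v $ i"
  by (simp add: diagm_def matrix_vector_mult_def if_distrib [of "\<lambda>x. x * _"] cong: if_cong)

lemma diagm_mult: "diagm d ** diagm e = diagm (\<lambda>i. d i * e i)"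
  by (simp add: matrix_eq matrix_vector_mul_assoc [symmetric] vec_eq_iff mult.assoc)

lemma diagm_one: "diagm (\<lambda>i. 1) = mat 1"
  by (simp add: diagm_def mat_def vec_eq_iff)

lemma adjm_mult_component: "(adjm U ** V) $ i $ j = cdot (column j V) (column i U)"
  by (simp add: adjm_def matrix_matrix_mult_def cdot_def column_def mult.commute)

lemma unitary_right: "unitary U \<Longrightarrow> U ** adjm U = mat 1"
  by (simp add: unitary_def matrix_left_right_inverse)

lemma unitary_adjm: "unitary U \<Longrightarrow> unitary (adjm U)"
  by (simp add: unitary_right unitary_def [of "adjm U"])

lemma cdot_unitary: "unitary U \<Longrightarrow> cdot (U *v v) (U *v w) = cdot v w"
  by (simp add: cdot_adjm matrix_vector_mul_assoc unitary_def)

lemma norm_unitary: "unitary U \<Longrightarrow> norm (U *v v) = norm v"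
proof -
  assume U: "unitary U"
  have "cdot (U *v v) (U *v v) = cdot v v" by (rule cdot_unitary [OF U])
  then have "(norm (U *v v))\<^sup>2 = (norm v)\<^sup>2"
    unfolding cdot_self using of_real_eq_iff by blast
  then show ?thesis by simp
qed

lemma unitary_ball:
  fixes U :: "complex ^ 'n ^ 'n"
  assumes "unitary U"
  shows "(*v) U ` ball 0 r = ball 0 r"
proof (intro equalityI subsetI)
  fix x :: "complex ^ 'n" assume "x \<in> ball 0 r"
  then have "x = U *v (adjm U *v x)" "adjm U *v x \<in> ball 0 r"
    using assms by (simp_all add: matrix_vector_mul_assoc unitary_right norm_unitary unitary_adjm)
  then show "x \<in> (*v) U ` ball 0 r" by blast
qed (use assms in \<open>auto simp: norm_unitary\<close>)

lemma cmod_det_unitary: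
  assumes "unitary U"
  shows "cmod (det U) = 1"
proof -
  have "det (adjm U) = cnj (det U)"
  proof -
    have "det (adjm U) = det (transpose (\<chi> i j. cnj (U $ i $ j)))"
      by (simp add: adjm_def transpose_def)
    also have "\<dots> = cnj (det U)"
      by (simp only: det_transpose) (simp add: det_def cnj_sum cnj_prod)
    finally show ?thesis .
  qed
  then have "cnj (det U) * det U = 1"
    using assms by (metis det_I det_mul unitary_def)
  then have "(cmod (det U))\<^sup>2 = 1"
    by (metis complex_norm_square mult.commute of_real_eq_1_iff)
  then show ?thesis by (simp add: power2_eq_1_iff) (use norm_ge_zero [of "det U"] in linarith)
qed

lemma bounded_linear_matrix: "bounded_linear ((*v) (A :: complex ^ 'n ^ 'm))"
  using linear_conv_bounded_linear matrix_vector_mul_linear_gen by blast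

section \<open>Spectral theorem for hermitian matrices\<close>

definition orthonormal :: "('n \<Rightarrow> complex ^ 'n) \<Rightarrow> bool" where
  "orthonormal f \<longleftrightarrow> (\<forall>i j. cdot (f i) (f j) = (if i = j then 1 else 0))"

text \<open>Here \<open>c\<close> and \<open>s\<close> stand for a cosine and a sine, and the
  unimodular \<open>\<omega>\<close> is a phase by which a complex off-diagonal entry can be made
  real.\<close>

definition plane_rotation :: "'n \<Rightarrow> 'n \<Rightarrow> real \<Rightarrow> real \<Rightarrow> complex \<Rightarrow> ('n \<Rightarrow> complex ^ 'n) \<Rightarrow> 'n \<Rightarrow> complex ^ 'n" where
  "plane_rotation p q c s \<omega> f i =
    (if i = p then of_real c *s f p + (of_real s * \<omega>) *s f q
     else if i = q then (- of_real s * cnj \<omega>) *s f p + of_real c *s f q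
     else f i)"

lemma orthonormal_rotate:
  assumes f: "orthonormal f" and "p \<noteq> q" and cs: "c\<^sup>2 + s\<^sup>2 = 1" and \<omega>: "\<omega> * cnj \<omega> = 1"
  shows "orthonormal (plane_rotation p q c s \<omega> f)"
proof -
  have d: "cdot (f i) (f j) = (if i = j then 1 else 0)" for i j
    using f by (simp add: orthonormal_def)
  have cs': "of_real c * of_real c + of_real s * of_real s = (1::complex)"
    using cs by (metis of_real_1 of_real_add of_real_mult power2_eq_square)
  have 1: "of_real c * of_real c + of_real s * \<omega> * (of_real s * cnj \<omega>) = (1::complex)"
    using \<omega> cs' by algebra
  show ?thesis
    unfolding orthonormal_def
  proof (intro allI)
    fix i j
    show "cdot (plane_rotation p q c s \<omega> f i) (plane_rotation p q c s \<omega> f j) = (if i = j then 1 else 0)"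
      using \<open>p \<noteq> q\<close> 1 by (auto simp: plane_rotation_def cdot_simps d) (simp_all add: mult_ac add.commute)
  qed
qed

text \<open>As \<open>H\<close> is hermitian, the two cross terms of the expansion are conjugate and
  add up to twice a real part. This term is the only one of first order in \<open>s\<close>, and it
  has opposite signs at \<open>p\<close> and \<open>q\<close>.\<close>

lemma hermitian_form_rotate:
  fixes f :: "'n \<Rightarrow> complex ^ 'n"
  assumes H: "adjm H = H" and "p \<noteq> q" and cs: "c\<^sup>2 + s\<^sup>2 = 1" and \<omega>: "\<omega> * cnj \<omega> = 1"
  defines "g \<equiv> \<lambda>f i. Re (cdot (H *v f i) (f i))"
  defines "r \<equiv> Re (\<omega> * cdot (H *v f q) (f p))"
  shows "g (plane_rotation p q c s \<omega> f) p = c\<^sup>2 * g f p + s\<^sup>2 * g f q + 2 * c * s * r"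
    and "g (plane_rotation p q c s \<omega> f) q = s\<^sup>2 * g f p + c\<^sup>2 * g f q - 2 * c * s * r"
proof -
  have cross: "cdot (H *v f p) (f q) = cnj (cdot (H *v f q) (f p))"
    by (metis H cdot_adjm cdot_commute)
  have lin: "H *v (a *s u + b *s v) = a *s (H *v u) + b *s (H *v v)" for a b u v
    by (simp add: vec.add vec.scale)
  have lin': "H *v (a *s u - b *s v) = a *s (H *v u) - b *s (H *v v)" for a b u v
    by (simp add: vec.diff vec.scale)
  let ?z = "cdot (H *v f q) (f p)"
  have "cdot (H *v plane_rotation p q c s \<omega> f p) (plane_rotation p q c s \<omega> f p)
    = of_real (c\<^sup>2) * cdot (H *v f p) (f p) + of_real (s\<^sup>2) * cdot (H *v f q) (f q)
      + of_real (c * s) * (\<omega> * ?z + cnj (\<omega> * ?z))"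
    using \<omega> by (simp add: plane_rotation_def lin lin' cdot_simps cross) algebra
  then show "g (plane_rotation p q c s \<omega> f) p = c\<^sup>2 * g f p + s\<^sup>2 * g f q + 2 * c * s * r"
    unfolding g_def r_def complex_add_cnj by simp
  have "cdot (H *v plane_rotation p q c s \<omega> f q) (plane_rotation p q c s \<omega> f q)
    = of_real (s\<^sup>2) * cdot (H *v f p) (f p) + of_real (c\<^sup>2) * cdot (H *v f q) (f q)
      - of_real (c * s) * (\<omega> * ?z + cnj (\<omega> * ?z))"
    using \<omega> by (simp add: plane_rotation_def lin lin' cdot_simps cross \<open>p \<noteq> q\<close> [symmetric]) algebra
  then show "g (plane_rotation p q c s \<omega> f) q = s\<^sup>2 * g f p + c\<^sup>2 * g f q - 2 * c * s * r"
    unfolding g_def r_def complex_add_cnj by simp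
qed

text \<open>Storing the vectors of a family as rows of a matrix places the families in a Euclidean
  space, where closed and bounded sets are compact.\<close>

lemma compact_orthonormal: "compact {W :: complex ^ 'n ^ 'n. orthonormal (($) W)}"
proof -
  have "closed {W :: complex ^ 'n ^ 'n. orthonormal (($) W)}"
    unfolding orthonormal_def cdot_def
    by (intro closed_Collect_all closed_Collect_eq continuous_intros)
  moreover have "bounded {W :: complex ^ 'n ^ 'n. orthonormal (($) W)}"
    unfolding bounded_iff
  proof (intro exI ballI)
    fix W :: "complex ^ 'n ^ 'n" assume "W \<in> {W. orthonormal (($) W)}"
    then have "of_real ((norm (W $ i))\<^sup>2) = (1::complex)" for i
      unfolding cdot_self [symmetric] by (simp add: orthonormal_def)
    then have "(norm (W $ i))\<^sup>2 = 1" for i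
      using of_real_eq_1_iff by blast
    then show "norm W \<le> sqrt (real CARD('n))"
      by (simp add: norm_vec_def [of W] L2_set_def)
  qed
  ultimately show ?thesis by (simp add: compact_eq_bounded_closed)
qed

text \<open>At a maximum of the weighted trace \<open>\<Sum>i. w i * \<langle>H (f i), f i\<rangle>\<close> over all orthonormal bases, with pairwise
  different weights, a rotation in the plane of any two basis vectors gives no gain to first order,
  so the off-diagonal entries vanish.\<close>

lemma diagonalizing_basis:
  fixes H :: "complex ^ 'n ^ 'n"
  assumes H: "adjm H = H"
  obtains f where "orthonormal f" "\<And>p q. p \<noteq> q \<Longrightarrow> cdot (H *v f q) (f p) = 0"
proof -
  obtain w :: "'n \<Rightarrow> nat" where w: "inj w"
    using finite_imp_inj_to_nat_seg [OF finite_class.finite_UNIV] by blast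
  define g where "g f i = Re (cdot (H *v f i) (f i))" for f :: "'n \<Rightarrow> complex ^ 'n" and i
  define \<Phi> where "\<Phi> f = (\<Sum>i\<in>UNIV. real (w i) * g f i)" for f
  let ?O = "{W :: complex ^ 'n ^ 'n. orthonormal (($) W)}"
  have "(\<chi> i. axis i 1) \<in> ?O"
    by (auto simp: orthonormal_def cdot_def axis_def if_distrib [of "\<lambda>x. x * _"] if_distrib [of cnj] cong: if_cong)
  then have "?O \<noteq> {}" by blast
  moreover have "continuous_on ?O (\<lambda>W. \<Phi> (($) W))"
    unfolding \<Phi>_def g_def cdot_def matrix_vector_mult_def
    by (simp del: Re_sum) (intro continuous_intros)
  ultimately obtain W where W: "W \<in> ?O" and max: "\<And>V. V \<in> ?O \<Longrightarrow> \<Phi> (($) V) \<le> \<Phi> (($) W)"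
    using continuous_attains_sup [OF compact_orthonormal] by metis
  define f where "f = ($) W"
  have f: "orthonormal f" using W by (simp add: f_def)
  have max: "\<Phi> f' \<le> \<Phi> f" if "orthonormal f'" for f'
    using max [of "vec_lambda f'"] that by (simp add: f_def vec_lambda_inverse)
  have zero: "cdot (H *v f q) (f p) = 0" if less: "w q < w p" for p q
  proof (rule ccontr)
    assume "cdot (H *v f q) (f p) \<noteq> 0"
    moreover define z where "z = cdot (H *v f q) (f p)"
    ultimately have z: "z \<noteq> 0" by simp
    \<comment> \<open>This phase turns the off-diagonal entry \<open>z\<close> into its
      modulus.\<close>
    define \<omega> where "\<omega> = cnj z / of_real (cmod z)"
    have zz: "cnj z * z = of_real (cmod z) * of_real (cmod z)"
      by (metis complex_norm_square mult.commute power2_eq_square of_real_mult)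
    have \<omega>: "\<omega> * cnj \<omega> = 1" "Re (\<omega> * z) = cmod z"
    proof -
      have "\<omega> * cnj \<omega> = (cnj z * z) / (of_real (cmod z) * of_real (cmod z))"
        by (simp add: \<omega>_def)
      then show "\<omega> * cnj \<omega> = 1" using z by (simp add: zz)
      have "\<omega> * z = (cnj z * z) / of_real (cmod z)" by (simp add: \<omega>_def)
      also have "\<dots> = of_real (cmod z)" using z by (simp add: zz)
      finally show "Re (\<omega> * z) = cmod z" by simp
    qed
    have pq: "p \<noteq> q" using less by blast
    \<comment> \<open>The rotation changes only the diagonal entries at \<open>p\<close> and
      \<open>q\<close>, by opposite amounts. The weight at \<open>p\<close> is the larger one, so
      maximality forbids a positive change there.\<close>
    have bound: "(2 * c * cmod z + s * (g f q - g f p)) * s \<le> 0" if cs: "c\<^sup>2 + s\<^sup>2 = 1" for c s :: real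
    proof -
      have c2: "c\<^sup>2 = 1 - s\<^sup>2" using cs by simp
      define f' where "f' = plane_rotation p q c s \<omega> f"
      have "0 \<ge> \<Phi> f' - \<Phi> f"
        using max [OF orthonormal_rotate [OF f pq cs \<omega>(1)]] by (simp add: f'_def)
      also have "\<Phi> f' - \<Phi> f = (\<Sum>i\<in>UNIV. real (w i) * (g f' i - g f i))"
        by (simp add: \<Phi>_def sum_subtractf right_diff_distrib)
      also have "\<dots> = (\<Sum>i\<in>{p, q}. real (w i) * (g f' i - g f i))"
        by (rule sum.mono_neutral_right) (auto simp: f'_def plane_rotation_def g_def)
      also have "\<dots> = real (w p) * (g f' p - g f p) + real (w q) * (g f' q - g f q)"
        using pq by simp
      also have "g f' p - g f p = s\<^sup>2 * (g f q - g f p) + 2 * c * s * cmod z"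
        using hermitian_form_rotate(1) [OF H pq cs \<omega>(1), of f, folded g_def f'_def z_def]
        unfolding \<omega>(2) c2 by (simp add: algebra_simps)
      also have "g f' q - g f q = - (s\<^sup>2 * (g f q - g f p) + 2 * c * s * cmod z)"
        using hermitian_form_rotate(2) [OF H pq cs \<omega>(1), of f, folded g_def f'_def z_def]
        unfolding \<omega>(2) c2 by (simp add: algebra_simps)
      finally have "(real (w p) - real (w q)) * (s\<^sup>2 * (g f q - g f p) + 2 * c * s * cmod z) \<le> 0"
        by (simp add: algebra_simps)
      then have "s\<^sup>2 * (g f q - g f p) + 2 * c * s * cmod z \<le> 0"
        using less by (simp add: mult_le_0_iff)
      then show ?thesis
        by (simp add: power2_eq_square algebra_simps)
    qed
    \<comment> \<open>Small angles \<open>s = t\<close>, \<open>c = sqrt (1 - t\<^sup>2)\<close>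
      contradict \<open>bound\<close>, since its first factor tends to
      \<open>2 * cmod z\<close>.\<close>
    have "\<forall>\<^sub>F t in at_right (0::real). 0 < 2 * sqrt (1 - t\<^sup>2) * cmod z + t * (g f q - g f p)"
    proof (rule order_tendstoD)
      show "((\<lambda>t. 2 * sqrt (1 - t\<^sup>2) * cmod z + t * (g f q - g f p)) \<longlongrightarrow>
          2 * sqrt (1 - 0\<^sup>2) * cmod z + 0 * (g f q - g f p)) (at_right 0)"
        by (intro tendsto_intros)
    qed (use z in auto)
    moreover have "\<forall>\<^sub>F t in at_right (0::real). t < 1 \<and> 0 < t"
      using eventually_at_right_real [of 0 1] by (auto elim: eventually_mono)
    ultimately have "\<forall>\<^sub>F t in at_right (0::real). False"
    proof eventually_elim
      case (elim t)
      have "t\<^sup>2 \<le> 1" using elim by (simp add: power_le_one)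
      then have "(sqrt (1 - t\<^sup>2))\<^sup>2 + t\<^sup>2 = 1" by simp
      from bound [OF this] elim show False by (simp add: mult_le_0_iff)
    qed
    then show False by simp
  qed
  show thesis
  proof (rule that [OF f])
    fix p q :: 'n assume "p \<noteq> q"
    show "cdot (H *v f q) (f p) = 0"
    proof (cases "w q < w p")
      case False
      then have "w p < w q" using w \<open>p \<noteq> q\<close> by (metis injD linorder_neqE_nat)
      then have "cdot (H *v f p) (f q) = 0" by (rule zero)
      then show ?thesis by (metis H cdot_adjm cdot_commute complex_cnj_zero)
    qed (rule zero)
  qed
qed

theorem hermitian_diagonalization:
  fixes H :: "complex ^ 'n ^ 'n"
  assumes H: "adjm H = H"
  obtains U d where "unitary U" "H = U ** diagm d ** adjm U"
proof -
  obtain f where f: "orthonormal f" and off: "\<And>p q. p \<noteq> q \<Longrightarrow> cdot (H *v f q) (f p) = 0"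
    using diagonalizing_basis [OF H] by blast
  define U where "U = (\<chi> i j. f j $ i)"
  have col: "column j U = f j" for j by (simp add: column_def U_def vec_eq_iff)
  have U: "unitary U"
    using f by (simp add: unitary_def vec_eq_iff adjm_mult_component col orthonormal_def mat_def)
  have real: "cdot (H *v f i) (f i) \<in> \<real>" for i
    unfolding Reals_cnj_iff cdot_commute by (simp add: cdot_adjm H)
  have colH: "column j (H ** U) = H *v f j" for j
    by (simp add: col [symmetric] column_def matrix_matrix_mult_def matrix_vector_mult_def)
  \<comment> \<open>The entry \<open>(i, j)\<close> of \<open>adjm U ** (H ** U)\<close> is
    \<open>cdot (H *v f j) (f i)\<close>, which vanishes off the diagonal.\<close>
  have D: "diagm (\<lambda>i. Re (cdot (H *v f i) (f i))) = adjm U ** (H ** U)"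
    by (auto simp: vec_eq_iff adjm_mult_component col colH diagm_def off of_real_Re real)
  have "U ** diagm (\<lambda>i. Re (cdot (H *v f i) (f i))) ** adjm U
      = (U ** adjm U) ** H ** (U ** adjm U)"
    unfolding D by (simp only: matrix_mul_assoc)
  then have "H = U ** diagm (\<lambda>i. Re (cdot (H *v f i) (f i))) ** adjm U"
    by (simp add: unitary_right [OF U])
  with U show thesis by (rule that)
qed

section \<open>Singular value decomposition\<close>

lemma invertible_adjm: "invertible A \<Longrightarrow> invertible (adjm A)"
  unfolding invertible_def
  by (metis adjm_mult adjm_diagm diagm_one)

text \<open>\<open>U\<close> diagonalizes \<open>S ** adjm S\<close>, the \<open>d i\<close> are the
  square roots of its eigenvalues, and the equation for \<open>S\<close> then determines
  \<open>V\<close>, which turns out to be unitary.\<close>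

lemma singular_value_decomposition:
  fixes S :: "complex ^ 'n ^ 'n"
  assumes "invertible S"
  obtains U V d where "unitary U" "unitary V" "\<forall>i. d i > 0" "S = U ** diagm d ** V"
proof -
  obtain U e where U: "unitary U" and e: "S ** adjm S = U ** diagm e ** adjm U"
    using hermitian_diagonalization [of "S ** adjm S"] by (auto simp: adjm_mult)
  have UU: "adjm U ** U = mat 1" "U ** adjm U = mat 1"
    using U unitary_right by (auto simp: unitary_def)
  have "diagm e = (adjm U ** U) ** diagm e ** (adjm U ** U)" by (simp add: UU)
  also have "\<dots> = adjm U ** (U ** diagm e ** adjm U) ** U" by (simp add: matrix_mul_assoc)
  also have "\<dots> = adjm U ** S ** adjm (adjm U ** S)"
    by (simp add: e [symmetric] adjm_mult matrix_mul_assoc)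
  finally have e2: "diagm e = adjm U ** S ** adjm (adjm U ** S)" .
  define A where "A = adjm (adjm U ** S)"
  have "invertible (adjm U)" using UU invertible_def by blast
  then have A: "invertible A" unfolding A_def using invertible_adjm invertible_mult assms by blast
  \<comment> \<open>The eigenvalue is the squared norm of the image of a standard basis vector under
    the invertible matrix \<open>A\<close>.\<close>
  have pos: "e i > 0" for i
  proof -
    have "of_real (e i) = cdot (diagm e *v axis i 1) (axis i 1)"
      by (simp add: cdot_def axis_def if_distrib [of "\<lambda>x. x * _"] if_distrib [of "\<lambda>x. _ * x"] if_distrib [of cnj] cong: if_cong)
    also have "\<dots> = cdot (A *v axis i 1) (A *v axis i 1)"
      by (simp add: e2 A_def adjm_mult cdot_adjm matrix_vector_mul_assoc [symmetric])
    finally have "e i = (norm (A *v axis i 1))\<^sup>2"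
      unfolding cdot_self using of_real_eq_iff by blast
    moreover have "A *v axis i 1 \<noteq> 0"
    proof
      assume "A *v axis i 1 = 0"
      moreover obtain B where "B ** A = mat 1" using A by (auto simp: invertible_def)
      ultimately have "axis i (1::complex) = 0"
        by (metis matrix_vector_mul_assoc matrix_vector_mul_lid matrix_vector_mult_0_right)
      then show False by simp
    qed
    ultimately show ?thesis by simp
  qed
  define d where "d i = sqrt (e i)" for i
  define V where "V = diagm (\<lambda>i. 1 / d i) ** (adjm U ** S)"
  have d: "d i > 0" "d i * d i = e i" for i using pos [of i] by (simp_all add: d_def)
  have "V ** adjm V = diagm (\<lambda>i. 1 / d i) ** diagm e ** diagm (\<lambda>i. 1 / d i)"
    unfolding e2 by (simp add: V_def adjm_mult matrix_mul_assoc)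
  also have "\<dots> = mat 1"
    using d(1) by (simp add: diagm_mult diagm_one [symmetric] d(2) [symmetric] less_imp_neq [symmetric])
  finally have V: "unitary V"
    by (simp add: unitary_def matrix_left_right_inverse)
  have "U ** diagm d ** V = U ** (diagm d ** diagm (\<lambda>i. 1 / d i)) ** adjm U ** S"
    by (simp add: V_def matrix_mul_assoc)
  then have "U ** diagm d ** V = S"
    using d(1) by (simp add: diagm_mult diagm_one less_imp_neq [symmetric] UU)
  then show thesis using d(1) by (intro that [OF U V, of d]) simp_all
qed

section \<open>Ellipsoids and hermitian forms\<close>

lemma linear_matrix: "linear ((*v) (A :: complex ^ 'n ^ 'm))"
  by (simp add: linear_conv_bounded_linear bounded_linear_matrix)

lemma inj_matrix: "invertible (A :: complex ^ 'n ^ 'n) \<Longrightarrow> inj ((*v) A)"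
  using invertible_eq_bij bij_is_inj by blast

lemma invertible_unitary: "unitary U \<Longrightarrow> invertible U"
  using unitary_right by (auto simp: unitary_def invertible_def)

lemma det_diagm: "det (diagm d) = (\<Prod>i\<in>UNIV. of_real (d i))"
  by (subst det_diagonal) (simp_all add: diagm_def)

lemma invertible_diagm: "(\<And>i. d i \<noteq> 0) \<Longrightarrow> invertible (diagm d)"
  by (simp add: invertible_det_nz det_diagm)

lemma measure_ball_pos: "measure lebesgue (ball (0 :: complex ^ 'n) 1) > 0"
  using content_ball_pos [of 1 "0 :: complex ^ 'n"] by (simp add: measure_def)

text \<open>The unknown scaling factor can be read off from any one set of positive volume. The unit
  ball is mapped to itself, so the factor is 1.\<close>

lemma measure_unitary_image:
  fixes S :: "(complex ^ 'n) set"
  assumes U: "unitary U" and S: "open S" "bounded S"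
  shows "measure lebesgue ((*v) U ` S) = measure lebesgue S"
proof -
  obtain k where k: "\<And>S. \<lbrakk>open S; bounded S\<rbrakk> \<Longrightarrow> measure lebesgue ((*v) U ` S) = k * measure lebesgue S"
    using measure_linear_image_factor [OF linear_matrix inj_matrix [OF invertible_unitary [OF U]]] by blast
  from k [of "ball 0 1"] have "k = 1"
    using measure_ball_pos [where 'n = 'n] by (simp add: unitary_ball [OF U])
  with k [OF S] show ?thesis by simp
qed

lemma Basis_complex_vec: "(Basis :: (complex ^ 'n) set) = (\<lambda>(i, u). axis i u) ` (UNIV \<times> {1, \<i>})"
  by (auto simp: Basis_vec_def Basis_complex_def)

lemma mem_complex_cube:
  "x \<in> box 0 (\<chi> i. Complex (d i) (d i)) \<longleftrightarrow>
    (\<forall>i. 0 < Re (x $ i) \<and> Re (x $ i) < d i \<and> 0 < Im (x $ i) \<and> Im (x $ i) < d i)"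
  by (auto simp: mem_box Basis_complex_vec inner_axis inner_complex_def)

lemma measure_complex_cube:
  assumes "\<And>i. d i > 0"
  shows "measure lebesgue (box 0 (\<chi> i::'n::finite. Complex (d i) (d i))) = (\<Prod>i\<in>UNIV. d i)\<^sup>2"
proof -
  let ?u = "\<chi> i::'n::finite. Complex (d i) (d i)"
  have inj: "inj_on (\<lambda>(i::'n::finite, u::complex). axis i u) (UNIV \<times> {1, \<i>})"
    by (auto simp: inj_on_def axis_eq_axis)
  have "measure lebesgue (box 0 ?u) = (\<Prod>b\<in>Basis. (?u - 0) \<bullet> b)"
    using assms by (subst measure_completion; simp) (auto simp: measure_lborel_box_eq Basis_complex_vec inner_axis inner_complex_def less_imp_le not_less)
  also have "\<dots> = (\<Prod>(i, u)\<in>UNIV \<times> {1, \<i>}. Complex (d i) (d i) \<bullet> u)"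
    unfolding Basis_complex_vec prod.reindex [OF inj] by (auto simp: inner_axis intro!: prod.cong)
  also have "\<dots> = (\<Prod>i\<in>UNIV. \<Prod>u\<in>{1, \<i>}. Complex (d i) (d i) \<bullet> u)"
    by (simp only: prod.cartesian_product)
  also have "\<dots> = (\<Prod>i\<in>UNIV. d i)\<^sup>2"
    by (simp add: inner_complex_def power2_eq_square prod.distrib)
  finally show ?thesis .
qed

text \<open>The scaling factor is read off from the unit cube, whose image is a box. Each
  \<open>d i\<close> occurs twice as a side length, for the real and for the imaginary part, hence
  the square.\<close>

lemma measure_diagm_image:
  fixes S :: "(complex ^ 'n) set"
  assumes d: "\<And>i. d i > 0" and S: "open S" "bounded S"
  shows "measure lebesgue ((*v) (diagm d) ` S) = (\<Prod>i\<in>UNIV. d i)\<^sup>2 * measure lebesgue S"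
proof -
  have inv: "invertible (diagm d)" using d by (intro invertible_diagm) (metis less_irrefl)
  obtain k where k: "\<And>S. \<lbrakk>open S; bounded S\<rbrakk> \<Longrightarrow> measure lebesgue ((*v) (diagm d) ` S) = k * measure lebesgue S"
    using measure_linear_image_factor [OF linear_matrix inj_matrix [OF inv]] by blast
  let ?C = "\<lambda>d. box 0 (\<chi> i::'n::finite. Complex (d i) (d i))"
  have "(*v) (diagm d) ` ?C (\<lambda>i. 1) = ?C d"
  proof (intro equalityI subsetI)
    fix x assume "x \<in> ?C d"
    then have "(\<chi> i. x $ i / of_real (d i)) \<in> ?C (\<lambda>i. 1)"
      using d unfolding mem_complex_cube by (simp add: Re_divide_of_real Im_divide_of_real)
    moreover have "x = diagm d *v (\<chi> i. x $ i / of_real (d i))"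
      using d by (simp add: vec_eq_iff less_imp_neq [symmetric])
    ultimately show "x \<in> (*v) (diagm d) ` ?C (\<lambda>i. 1)" by blast
  next
    fix x assume "x \<in> (*v) (diagm d) ` ?C (\<lambda>i. 1)"
    then obtain y where y: "y \<in> ?C (\<lambda>i. 1)" "x = diagm d *v y" by blast
    have "\<not> d i \<le> 0" for i using d [of i] by simp
    then show "x \<in> ?C d"
      using y(1) d unfolding y(2) mem_complex_cube by (simp add: mult_less_cancel_left2)
  qed
  with k [OF open_box bounded_box, of 0 "\<chi> i. Complex 1 1"] have "k = (\<Prod>i\<in>UNIV. d i)\<^sup>2"
    using measure_complex_cube [of "\<lambda>i::'n. 1"] measure_complex_cube [of d] d by simp
  with k [OF S] show ?thesis by simp
qed

lemma matrix_image_ball: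
  fixes M :: "complex ^ 'n ^ 'n"
  assumes "invertible M"
  shows "open ((*v) M ` ball 0 r)" "bounded ((*v) M ` ball 0 r)"
  using open_linear_bij_image [OF linear_matrix inj_matrix [OF assms]]
    bounded_linear_image [OF bounded_ball bounded_linear_matrix] by blast+

text \<open>In the singular value decomposition \<open>V\<close> preserves the ball and
  \<open>U\<close> preserves volume, so only the diagonal factor counts. The product of its entries
  is the modulus of the determinant.\<close>

lemma measure_matrix_ball:
  fixes M :: "complex ^ 'n ^ 'n"
  assumes "invertible M"
  shows "measure lebesgue ((*v) M ` ball 0 1) = (cmod (det M))\<^sup>2 * measure lebesgue (ball (0 :: complex ^ 'n) 1)"
proof -
  obtain U V d where U: "unitary U" and V: "unitary V" and "\<forall>i. d i > 0" and M: "M = U ** diagm d ** V"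
    by (rule singular_value_decomposition [OF assms])
  then have d: "d i > 0" for i by blast
  have inv: "invertible (diagm d)" using d by (intro invertible_diagm) (metis less_irrefl)
  have "(*v) M ` ball 0 1 = (*v) U ` (*v) (diagm d) ` (*v) V ` ball 0 1"
    by (simp add: M image_image matrix_vector_mul_assoc matrix_mul_assoc)
  then have "(*v) M ` ball 0 1 = (*v) U ` (*v) (diagm d) ` ball 0 1"
    by (simp only: unitary_ball [OF V])
  then have "measure lebesgue ((*v) M ` ball 0 1) = measure lebesgue ((*v) U ` (*v) (diagm d) ` ball 0 1)"
    by (simp only:)
  also note measure_unitary_image [OF U matrix_image_ball [OF inv]]
  also note measure_diagm_image [OF d open_ball bounded_ball]
  finally have "measure lebesgue ((*v) M ` ball 0 1) = (\<Prod>i\<in>UNIV. d i)\<^sup>2 * measure lebesgue (ball (0 :: complex ^ 'n) 1)" .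
  moreover have "cmod (det M) = (\<Prod>i\<in>UNIV. d i)"
    using d by (simp add: M det_mul norm_mult cmod_det_unitary U V det_diagm abs_of_pos flip: prod_norm)
  ultimately show ?thesis by simp
qed

section \<open>Matrices representing ellipsoids and forms\<close>

lemma hermitian_ellipsoid_iff:
  fixes E :: "(complex ^ 'n) set"
  shows
  "E \<in> hermitian_ellipsoids \<longleftrightarrow> (\<exists>M :: complex ^ 'n ^ 'n. invertible M \<and> E = (*v) M ` ball 0 1)"
proof
  assume "E \<in> hermitian_ellipsoids"
  then obtain T :: "complex ^ 'n \<Rightarrow> complex ^ 'n" where T: "clinear T" "bij T" "E = T ` ball 0 1"
    unfolding hermitian_ellipsoids_def by blast
  have "(*v) (matrix T) = T" using matrix_works [OF T(1)] by blast
  with T show "\<exists>M :: complex ^ 'n ^ 'n. invertible M \<and> E = (*v) M ` ball 0 1"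
    by (intro exI [of _ "matrix T"]) (simp add: invertible_eq_bij)
next
  assume "\<exists>M :: complex ^ 'n ^ 'n. invertible M \<and> E = (*v) M ` ball 0 1"
  then show "E \<in> hermitian_ellipsoids"
    unfolding hermitian_ellipsoids_def invertible_eq_bij
    by (auto intro: matrix_vector_mul_linear_gen)
qed

text \<open>The columns of \<open>M\<close> form an orthonormal basis for \<open>h\<close>: an
  eigenbasis of the Gram matrix, rescaled by the roots of the eigenvalues. In these coordinates the
  ellipsoid of \<open>h\<close> is the unit ball.\<close>

lemma pos_def_form_matrix:
  fixes h :: "complex ^ 'n \<Rightarrow> complex ^ 'n \<Rightarrow> complex"
  assumes h: "pos_def_hermitian_form h"
  obtains M :: "complex ^ 'n ^ 'n" where "invertible M" "\<And>v w. h (M *v v) (M *v w) = cdot v w"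
proof -
  have lin: "Vector_Spaces.linear (*s) (*) (\<lambda>z. h z w)" and sym: "h w z = cnj (h z w)" for z w
    using h unfolding pos_def_hermitian_form_def by blast+
  \<comment> \<open>The indices are swapped because \<open>cdot (H *v z) w\<close> pairs the row
    index with the second argument.\<close>
  define H where "H = (\<chi> i j. h (axis j 1) (axis i 1))"
  have expand: "z = (\<Sum>i\<in>UNIV. z $ i *s axis i 1)" for z :: "complex ^ 'n"
    by (simp add: vec_eq_iff axis_def if_distrib cong: if_cong)
  have left: "h z w = (\<Sum>i\<in>UNIV. z $ i * h (axis i 1) w)" for z w
  proof -
    interpret Vector_Spaces.linear "(*s)" "(*)" "\<lambda>z. h z w" by (rule lin)
    show ?thesis by (subst expand) (simp add: sum scale)
  qed
  have h_eq: "h z w = cdot (H *v z) w" for z w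
  proof -
    have "h z w = (\<Sum>j\<in>UNIV. z $ j * cnj (\<Sum>i\<in>UNIV. w $ i * h (axis i 1) (axis j 1)))"
      by (subst left, subst sym, subst left, simp)
    also have "\<dots> = (\<Sum>j\<in>UNIV. \<Sum>i\<in>UNIV. H $ i $ j * z $ j * cnj (w $ i))"
      by (simp add: H_def cnj_sum sum_distrib_left sym [symmetric] mult_ac)
    also have "\<dots> = cdot (H *v z) w"
      unfolding cdot_def matrix_vector_mult_def by (subst sum.swap) (simp add: sum_distrib_right)
    finally show ?thesis .
  qed
  have "adjm H = H" by (simp add: adjm_def H_def vec_eq_iff sym [symmetric])
  then obtain U d where U: "unitary U" and H: "H = U ** diagm d ** adjm U"
    by (rule hermitian_diagonalization)
  have h_U: "h (U *v v) (U *v w) = cdot (diagm d *v v) w" for v w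
  proof -
    have "H *v (U *v v) = U *v (diagm d *v ((adjm U ** U) *v v))"
      by (simp add: H matrix_vector_mul_assoc matrix_mul_assoc)
    then have HU: "H *v (U *v v) = U *v (diagm d *v v)"
      using U by (simp add: unitary_def)
    show ?thesis unfolding h_eq HU cdot_unitary [OF U] ..
  qed
  have d: "d i > 0" for i
  proof -
    have "U *v axis i 1 \<noteq> 0"
      using norm_unitary [OF U, of "axis i 1"] by (auto simp: norm_axis_1)
    then have "0 < Re (h (U *v axis i 1) (U *v axis i 1))"
      using h unfolding pos_def_hermitian_form_def by blast
    then show ?thesis
      by (simp add: h_U cdot_def axis_def if_distrib [of "\<lambda>x. x * _"] if_distrib [of "\<lambda>x. _ * x"] if_distrib [of cnj] cong: if_cong)
  qed
  define M where "M = U ** diagm (\<lambda>i. 1 / sqrt (d i))"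
  have M: "invertible M"
    unfolding M_def using d by (intro invertible_mult invertible_unitary [OF U] invertible_diagm) (simp add: less_imp_neq [symmetric])
  have "h (M *v v) (M *v w) = cdot v w" for v w
  proof -
    have dd: "complex_of_real (d i) * (of_real (1 / sqrt (d i)) * x) * cnj (of_real (1 / sqrt (d i)) * y) = x * cnj y" for i x y
    proof -
      have "complex_of_real (d i) * (of_real (1 / sqrt (d i)) * x) * cnj (of_real (1 / sqrt (d i)) * y)
          = of_real (d i * (1 / sqrt (d i)) * (1 / sqrt (d i))) * (x * cnj y)"
        by (simp only: complex_cnj_mult complex_cnj_complex_of_real of_real_mult mult_ac)
      also have "d i * (1 / sqrt (d i)) * (1 / sqrt (d i)) = 1"
        using d [of i] by (simp add: divide_simps)
      finally show ?thesis by simp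
    qed
    show ?thesis
      unfolding M_def matrix_vector_mul_assoc [symmetric] h_U cdot_def diagm_vec
      by (intro sum.cong refl dd)
  qed
  then show thesis by (rule that [OF M])
qed

lemma ellipsoid_of_matrix:
  assumes M: "invertible M" and h: "\<And>v w. h (M *v v) (M *v w) = cdot v w"
  shows "ellipsoid_of h = (*v) M ` ball 0 1"
proof -
  have "Re (h (M *v v) (M *v v)) < 1 \<longleftrightarrow> v \<in> ball 0 1" for v
    by (simp add: h cdot_self power_less_one_iff del: of_real_power)
  then have "ellipsoid_of h \<inter> range ((*v) M) = (*v) M ` ball 0 1"
    unfolding ellipsoid_of_def by blast
  moreover have "range ((*v) M) = UNIV"
    using M by (simp add: invertible_eq_bij bij_is_surj)
  ultimately show ?thesis by simp
qed

section \<open>Interpolation of ellipsoids in pseudoconvex domains\<close>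

text \<open>The terms in \<open>cos \<theta>\<close> and \<open>cos (2 * \<theta>)\<close> have mean
  zero over the circle, so only \<open>a\<close> survives in the sub-mean-value inequality.\<close>

lemma submean_trigonometric_bound:
  assumes f: "subharmonic_on S f" and s: "0 < s" "cball 0 s \<subseteq> S"
    and le: "\<And>\<theta>. f (of_real s * cis \<theta>) \<le> a + b * cos \<theta> + c * cos (2 * \<theta>)"
  shows "f 0 \<le> a"
proof -
  define F where "F \<theta> = a * \<theta> + b * sin \<theta> + c * sin (2 * \<theta>) / 2" for \<theta>
  have "(F has_vector_derivative (a + b * cos \<theta> + c * cos (2 * \<theta>))) (at \<theta> within {0..2 * pi})" for \<theta>
    unfolding F_def has_real_derivative_iff_has_vector_derivative [symmetric]
    by (auto intro!: derivative_eq_intros)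
  then have F: "((\<lambda>\<theta>. a + b * cos \<theta> + c * cos (2 * \<theta>)) has_integral (F (2 * pi) - F 0)) {0..2 * pi}"
    by (intro fundamental_theorem_of_calculus) auto
  have sin4: "sin (2 * (2 * pi)) = 0"
    by (simp only: sin_double [of "2 * pi"]) simp
  have "(\<lambda>\<theta>. f (of_real s * cis \<theta>)) absolutely_integrable_on {0..2 * pi}"
    and mean: "f 0 \<le> 1 / (2 * pi) * integral {0..2 * pi} (\<lambda>\<theta>. f (of_real s * cis \<theta>))"
  proof -
    have "(\<lambda>\<theta>. f (0 + of_real s * cis \<theta>)) absolutely_integrable_on {0..2 * pi} \<and>
        f 0 \<le> 1 / (2 * pi) * integral {0..2 * pi} (\<lambda>\<theta>. f (0 + of_real s * cis \<theta>))"
      using f s unfolding subharmonic_on_def by blast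
    then show "(\<lambda>\<theta>. f (of_real s * cis \<theta>)) absolutely_integrable_on {0..2 * pi}"
      "f 0 \<le> 1 / (2 * pi) * integral {0..2 * pi} (\<lambda>\<theta>. f (of_real s * cis \<theta>))"
      by simp_all
  qed
  then have "integral {0..2 * pi} (\<lambda>\<theta>. f (of_real s * cis \<theta>)) \<le> integral {0..2 * pi} (\<lambda>\<theta>. a + b * cos \<theta> + c * cos (2 * \<theta>))"
    using F le by (intro integral_le) (auto simp: absolutely_integrable_on_def)
  also have "\<dots> = F (2 * pi) - F 0" using F by (rule integral_unique)
  also have "\<dots> = 2 * pi * a" by (simp add: F_def sin4)
  finally have "1 / (2 * pi) * integral {0..2 * pi} (\<lambda>\<theta>. f (of_real s * cis \<theta>)) \<le> 1 / (2 * pi) * (2 * pi * a)"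
    by (intro mult_left_mono) auto
  with mean show ?thesis by simp
qed

text \<open>The second order term \<open>- Re (x\<^sup>2)\<close> is harmonic, so it has no influence on circle means.\<close>

lemma one_plus_exp_expansion:
  assumes "cmod x \<le> 1/2"
  shows "\<bar>(cmod (1 + x))\<^sup>2 * exp (- 2 * Re x) - (1 - Re (x\<^sup>2))\<bar> \<le> 16 * cmod x ^ 3"
proof -
  define a b r where "a = Re x" and "b = Im x" and "r = cmod x"
  have r: "0 \<le> r" "r \<le> 1/2" "\<bar>a\<bar> \<le> r" and r2: "a\<^sup>2 + b\<^sup>2 = r\<^sup>2"
    using assms by (auto simp: a_def b_def r_def abs_Re_le_cmod cmod_power2)
  \<comment> \<open>Taylor expansion of the exponential to second order with Lagrange remainder,
    which becomes \<open>w\<close>.\<close>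
  obtain t where t: "\<bar>t\<bar> \<le> \<bar>- 2 * a\<bar>" and "exp (- 2 * a) = (\<Sum>m<3. (- 2 * a) ^ m / fact m) + exp t / fact 3 * (- 2 * a) ^ 3"
    using Maclaurin_exp_le by blast
  then have E: "exp (- 2 * a) = 1 - 2 * a + 2 * a\<^sup>2 - exp t * 4 / 3 * a ^ 3"
    by (simp add: eval_nat_numeral field_simps)
  define w where "w = exp t * 4 / 3 * a ^ 3"
  define k where "k = 2 * a\<^sup>2 - 2 * a"
  define P where "P = 1 + 2 * a + r\<^sup>2"
  have E: "exp (- 2 * Re x) = 1 - 2 * a + 2 * a\<^sup>2 - w"
    using E unfolding a_def w_def .
  have "\<bar>t\<bar> \<le> 1" using t r by simp
  then have "exp t \<le> exp 1" by simp
  then have t3: "exp t \<le> 3" using exp_le by linarith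
  have a3: "\<bar>a ^ 3\<bar> \<le> r ^ 3" using power_mono [OF r(3), of 3] by (simp add: power_abs)
  have w: "\<bar>w\<bar> \<le> 4 * r ^ 3"
  proof -
    have "\<bar>w\<bar> = exp t * 4 / 3 * \<bar>a ^ 3\<bar>" by (simp add: w_def abs_mult)
    also have "\<dots> \<le> 4 * r ^ 3" by (rule mult_mono) (use a3 t3 r in simp_all)
    finally show ?thesis .
  qed
  have rr: "r\<^sup>2 \<le> r / 2" using r mult_left_mono [of r "1/2" r] by (simp add: power2_eq_square)
  have "a\<^sup>2 \<le> r\<^sup>2" using r2 zero_le_power2 [of b] by linarith
  then have "\<bar>k\<bar> \<le> 3 * r"
    unfolding k_def using rr r zero_le_power2 [of a] by linarith
  then have k: "\<bar>r\<^sup>2 * k\<bar> \<le> 3 * r ^ 3"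
    using mult_left_mono [of "\<bar>k\<bar>" "3 * r" "r\<^sup>2"] by (simp add: abs_mult power2_eq_square power3_eq_cube)
  have "0 \<le> P" "P \<le> 9 / 4"
    unfolding P_def using rr r zero_le_power2 [of r] by linarith+
  then have Pw: "\<bar>P * w\<bar> \<le> 9 * r ^ 3"
    using mult_mono [of P "9 / 4" "\<bar>w\<bar>" "4 * r ^ 3"] w by (simp add: abs_mult)
  have P: "(cmod (1 + x))\<^sup>2 = P"
    unfolding P_def cmod_power2 r2 [symmetric] by (simp add: a_def b_def power2_eq_square algebra_simps)
  have "Re (x\<^sup>2) = a\<^sup>2 - b\<^sup>2" by (simp add: a_def b_def Re_power2)
  then have Re2: "Re (x\<^sup>2) = 2 * a\<^sup>2 - r\<^sup>2" using r2 by linarith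
  \<comment> \<open>All terms of order at most two cancel. The remaining three are bounded by 4, 3
    and 9 times \<open>r ^ 3\<close>, which gives the constant 16.\<close>
  have "(cmod (1 + x))\<^sup>2 * exp (- 2 * Re x) - (1 - Re (x\<^sup>2)) = 4 * a ^ 3 + r\<^sup>2 * k - P * w"
    unfolding P E Re2
    by (simp add: k_def P_def power2_eq_square power3_eq_cube algebra_simps)
  then show ?thesis unfolding r_def [symmetric] using a3 k Pw by linarith
qed

text \<open>\<open>{y. ellnorm l t y < 1}\<close> is the image of the unit ball under the diagonal matrix with entries
  \<open>exp (t * l i)\<close>.\<close>

definition ellnorm :: "('n \<Rightarrow> real) \<Rightarrow> real \<Rightarrow> complex ^ 'n \<Rightarrow> real" where
  "ellnorm l t y = (\<Sum>i\<in>UNIV. exp (- 2 * t * l i) * (cmod (y $ i))\<^sup>2)"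

lemma continuous_on_ellnorm [continuous_intros]:
  assumes "continuous_on S f" "continuous_on S g"
  shows "continuous_on S (\<lambda>x. ellnorm l (f x) (g x))"
  unfolding ellnorm_def using assms by (intro continuous_intros)

lemma ellnorm_nonneg: "ellnorm l t y \<ge> 0"
  by (simp add: ellnorm_def sum_nonneg)

lemma ellnorm_scaleR: "ellnorm l t (r *\<^sub>R y) = r\<^sup>2 * ellnorm l t y"
  by (simp add: ellnorm_def sum_distrib_left power_mult_distrib mult_ac)

lemma ellnorm_eq_0: "ellnorm l t y = 0 \<longleftrightarrow> y = 0"
  by (simp add: ellnorm_def sum_nonneg_eq_0_iff vec_eq_iff)

text \<open>For \<open>t\<close> in the unit interval all weights are at least
  \<open>exp (- 2 * b)\<close>, so \<open>ellnorm\<close> controls the Euclidean norm uniformly in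
  \<open>t\<close>.\<close>

lemma compact_ellnorm:
  "compact {(t, y). t \<in> {0..1} \<and> ellnorm l t y \<le> R}"
proof -
  obtain b where b: "\<And>i. \<bar>l i\<bar> \<le> b"
  proof
    show "\<bar>l i\<bar> \<le> (\<Sum>i\<in>UNIV. \<bar>l i\<bar>)" for i by (intro member_le_sum) auto
  qed
  have b0: "b \<ge> 0" using b [of undefined] by linarith
  have "norm y \<le> sqrt (exp (2 * b) * R)" if t: "t \<in> {0..1}" and y: "ellnorm l t y \<le> R" for t y
  proof -
    have tl: "t * l i \<le> b" for i
    proof -
      have "t * l i \<le> t * b" using b [of i] t by (intro mult_left_mono) auto
      also have "\<dots> \<le> b" using t b0 by (simp add: mult_left_le_one_le)
      finally show ?thesis .
    qed
    have "exp (- 2 * b) * (norm y)\<^sup>2 = (\<Sum>i\<in>UNIV. exp (- 2 * b) * (cmod (y $ i))\<^sup>2)"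
      by (simp add: norm_vec_def L2_set_def sum_nonneg sum_distrib_left)
    also have "\<dots> \<le> ellnorm l t y"
      unfolding ellnorm_def using tl by (intro sum_mono mult_right_mono) auto
    finally have "exp (2 * b) * (exp (- 2 * b) * (norm y)\<^sup>2) \<le> exp (2 * b) * R"
      using y by (intro mult_left_mono) auto
    then have "(norm y)\<^sup>2 \<le> exp (2 * b) * R"
      by (simp add: mult.assoc [symmetric] exp_add [symmetric])
    then show ?thesis by (rule real_le_rsqrt)
  qed
  then have "{(t, y). t \<in> {0..1} \<and> ellnorm l t y \<le> R} \<subseteq> {0..1} \<times> cball 0 (sqrt (exp (2 * b) * R))"
    by auto
  then have "bounded {(t, y). t \<in> {0..1} \<and> ellnorm l t y \<le> R}"
    by (rule bounded_subset [rotated]) (intro bounded_Times bounded_closed_interval bounded_cball)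
  moreover have "closed {(t, y). t \<in> {0..1} \<and> ellnorm l t y \<le> R}"
    unfolding case_prod_beta atLeastAtMost_iff
    by (intro closed_Collect_conj closed_Collect_le continuous_intros)
  ultimately show ?thesis by (simp add: compact_eq_bounded_closed)
qed

text \<open>The complex tangent line at \<open>y\<close> of the curve \<open>\<sigma> \<mapsto> exp (\<sigma> l) y\<close>.\<close>

definition tangent :: "('n \<Rightarrow> real) \<Rightarrow> complex ^ 'n \<Rightarrow> complex \<Rightarrow> complex ^ 'n" where
  "tangent l y \<sigma> = (\<chi> i. y $ i * (1 + \<sigma> * of_real (l i)))"

text \<open>In each coordinate this is \<open>one_plus_exp_expansion\<close> at
  \<open>x = \<sigma> * l i\<close>; the shift of \<open>t\<close> by \<open>Re \<sigma>\<close>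
  supplies its exponential factor. \<open>Q\<close> and \<open>C\<close> collect the second and
  third order coefficients.\<close>

lemma ellnorm_tangent:
  obtains Q C \<epsilon> where "Q \<ge> 0" "C \<ge> 0" "\<epsilon> > 0"
    "\<And>\<sigma>. cmod \<sigma> \<le> \<epsilon> \<Longrightarrow> \<bar>ellnorm l (t + Re \<sigma>) (tangent l y \<sigma>) - ellnorm l t y + Re (\<sigma>\<^sup>2) * Q\<bar> \<le> C * cmod \<sigma> ^ 3"
proof -
  obtain b where b: "\<And>i. \<bar>l i\<bar> \<le> b"
  proof
    show "\<bar>l i\<bar> \<le> (\<Sum>i\<in>UNIV. \<bar>l i\<bar>)" for i by (intro member_le_sum) auto
  qed
  have b0: "b \<ge> 0" using b [of undefined] by linarith
  define e where "e i = exp (- 2 * t * l i) * (cmod (y $ i))\<^sup>2" for i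
  define Q where "Q = (\<Sum>i\<in>UNIV. e i * (l i)\<^sup>2)"
  define C where "C = (\<Sum>i\<in>UNIV. e i * (16 * \<bar>l i\<bar> ^ 3))"
  have e: "e i \<ge> 0" for i by (simp add: e_def)
  show thesis
  \<comment> \<open>This radius ensures \<open>cmod (x i) \<le> 1 / 2\<close>; the summand 1 keeps
    the denominator positive when \<open>b = 0\<close>.\<close>
  proof (rule that [of Q C "1 / (2 * (b + 1))"])
    show "Q \<ge> 0" "C \<ge> 0" using e by (auto simp: Q_def C_def intro!: sum_nonneg mult_nonneg_nonneg)
    show "1 / (2 * (b + 1)) > 0" using b0 by simp
    fix \<sigma> assume \<sigma>: "cmod \<sigma> \<le> 1 / (2 * (b + 1))"
    define x where "x i = \<sigma> * of_real (l i)" for i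
    have x: "cmod (x i) \<le> 1 / 2" for i
    proof -
      have "cmod (x i) \<le> 1 / (2 * (b + 1)) * (b + 1)"
        unfolding x_def norm_mult using b [of i] b0 \<sigma> by (intro mult_mono) auto
      also have "\<dots> = 1 / 2" using b0 by (simp add: field_simps)
      finally show ?thesis .
    qed
    have 1: "exp (- 2 * (t + Re \<sigma>) * l i) * (cmod (tangent l y \<sigma> $ i))\<^sup>2
        = e i * ((cmod (1 + x i))\<^sup>2 * exp (- 2 * Re (x i)))" for i
    proof -
      have "tangent l y \<sigma> $ i = y $ i * (1 + x i)"
        by (simp add: tangent_def x_def)
      moreover have "exp (- 2 * (t + Re \<sigma>) * l i) = exp (- 2 * t * l i) * exp (- 2 * Re (x i))"
        by (simp add: x_def exp_add [symmetric] algebra_simps)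
      ultimately show ?thesis by (simp add: e_def norm_mult power_mult_distrib)
    qed
    have "ellnorm l (t + Re \<sigma>) (tangent l y \<sigma>) - ellnorm l t y + Re (\<sigma>\<^sup>2) * Q
       = (\<Sum>i\<in>UNIV. e i * ((cmod (1 + x i))\<^sup>2 * exp (- 2 * Re (x i)) - (1 - Re ((x i)\<^sup>2))))"
    proof -
      have 2: "Re ((x i)\<^sup>2) = Re (\<sigma>\<^sup>2) * (l i)\<^sup>2" for i
        by (simp add: x_def power_mult_distrib flip: of_real_power)
      show ?thesis
        unfolding ellnorm_def 1 Q_def sum_distrib_left 2 sum_subtractf [symmetric] sum.distrib [symmetric]
        by (intro sum.cong refl) (simp add: e_def algebra_simps)
    qed
    also have "\<bar>\<dots>\<bar> \<le> (\<Sum>i\<in>UNIV. \<bar>e i * ((cmod (1 + x i))\<^sup>2 * exp (- 2 * Re (x i)) - (1 - Re ((x i)\<^sup>2)))\<bar>)"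
      by (rule sum_abs)
    also have "\<dots> \<le> (\<Sum>i\<in>UNIV. e i * (16 * cmod (x i) ^ 3))"
      unfolding abs_mult abs_of_nonneg [OF e]
      by (intro sum_mono mult_left_mono one_plus_exp_expansion x e)
    also have "\<dots> = C * cmod \<sigma> ^ 3"
      by (simp add: C_def x_def sum_distrib_left norm_mult power_mult_distrib mult_ac)
    finally show "\<bar>ellnorm l (t + Re \<sigma>) (tangent l y \<sigma>) - ellnorm l t y + Re (\<sigma>\<^sup>2) * Q\<bar> \<le> C * cmod \<sigma> ^ 3" .
  qed
qed

text \<open>Plurisubharmonicity is only assumed along complex lines, whereas the curves \<open>\<sigma> \<mapsto> exp (\<sigma> l) y\<close> are not lines.
  At a maximum point \<open>(t, y)\<close> of \<open>u (A y) + \<delta> t\<^sup>2\<close> minus a penalty in \<open>ellnorm l t y\<close>, the curve is replaced by its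
  tangent line; the penalty changes along it by a harmonic quadratic term and a cubic error, which is
  too small to offset the gain from \<open>\<delta> t\<^sup>2\<close>.\<close>

lemma max_principle_ellipsoids:
  fixes A :: "complex ^ 'n ^ 'm" and u :: "complex ^ 'm \<Rightarrow> real"
  assumes cont: "continuous_on \<Omega> u" and psh: "plurisubharmonic_on \<Omega> u"
    and sub: "\<And>t y. \<lbrakk>t \<in> {0..1}; ellnorm l t y \<le> R\<rbrakk> \<Longrightarrow> A *v y \<in> \<Omega>"
    and bd: "\<And>t y. \<lbrakk>t \<in> {0, 1}; ellnorm l t y \<le> R\<rbrakk> \<Longrightarrow> u (A *v y) \<le> c"
    and t0: "t0 \<in> {0..1}" and y0: "ellnorm l t0 y0 < R"
  shows "u (A *v y0) \<le> c"
proof (rule ccontr)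
  assume "\<not> u (A *v y0) \<le> c"
  define N where "N = ellnorm l"
  \<comment> \<open>Half the excess over \<open>c\<close>: adding
    \<open>\<delta> * t\<^sup>2 \<le> \<delta>\<close> to a value at most \<open>c\<close> still
    stays below \<open>c + 2 * \<delta>\<close>.\<close>
  define \<delta> where "\<delta> = (u (A *v y0) - c) / 2"
  have \<delta>: "\<delta> > 0" "u (A *v y0) = c + 2 * \<delta>"
    using \<open>\<not> u (A *v y0) \<le> c\<close> by (auto simp: \<delta>_def field_simps)
  define Y where "Y = {(t, y). t \<in> {0..1} \<and> N t y \<le> R}"
  have Y: "compact Y" "(t0, y0) \<in> Y"
    using compact_ellnorm t0 y0 by (auto simp: Y_def N_def)
  have contA: "continuous_on Y (\<lambda>(t, y). u (A *v y))"
    unfolding case_prod_beta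
  proof (rule continuous_on_compose2 [OF cont])
    show "continuous_on Y (\<lambda>x. A *v snd x)"
      unfolding matrix_vector_mult_def by (intro continuous_intros)
    show "(\<lambda>x. A *v snd x) ` Y \<subseteq> \<Omega>"
      using sub by (auto simp: Y_def N_def)
  qed
  obtain B where B: "\<And>t y. (t, y) \<in> Y \<Longrightarrow> u (A *v y) \<le> B"
  proof -
    obtain x where "x \<in> Y" and x: "\<forall>z\<in>Y. (\<lambda>(t, y). u (A *v y)) z \<le> (\<lambda>(t, y). u (A *v y)) x"
      using continuous_attains_sup [OF Y(1) _ contA] Y(2) by blast
    show thesis
    proof (rule that)
      show "u (A *v y) \<le> u (A *v snd x)" if "(t, y) \<in> Y" for t y
        using bspec [OF x that] by (simp add: case_prod_beta)
    qed
  qed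
  define N0 where "N0 = N t0 y0"
  have N0: "N0 < R" using y0 by (simp add: N0_def N_def)
  \<comment> \<open>The penalty vanishes up to the level \<open>N0\<close> of the given point. The
    factor \<open>k\<close> makes it equal to \<open>m\<close> on the level \<open>R\<close>, which
    pushes \<open>\<Psi>\<close> below \<open>u (A *v y0)\<close> there.\<close>
  define p where "p x = (max 0 (x - N0))\<^sup>2" for x
  define m where "m = \<bar>B\<bar> + \<delta> + \<bar>u (A *v y0)\<bar> + 1"
  define k where "k = m / (R - N0)\<^sup>2"
  have m: "m > 0" using \<delta> by (simp add: m_def)
  have k: "k > 0" using m N0 by (simp add: k_def)
  define \<Psi> where "\<Psi> t y = u (A *v y) + \<delta> * t\<^sup>2 - k * p (N t y)" for t y
  have "continuous_on Y (\<lambda>(t, y). \<Psi> t y)"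
    using contA unfolding \<Psi>_def p_def N_def case_prod_beta by (intro continuous_intros)
  then obtain z where "z \<in> Y" "\<forall>x\<in>Y. (\<lambda>(t, y). \<Psi> t y) x \<le> (\<lambda>(t, y). \<Psi> t y) z"
    using continuous_attains_sup [OF Y(1)] Y(2) by blast
  moreover obtain t1 y1 where "z = (t1, y1)" by (cases z)
  ultimately have z: "(t1, y1) \<in> Y" and max: "\<And>t y. (t, y) \<in> Y \<Longrightarrow> \<Psi> t y \<le> \<Psi> t1 y1"
    by auto
  have p0: "p x \<ge> 0" for x by (simp add: p_def)
  have "u (A *v y0) \<le> \<Psi> t0 y0" using \<delta> by (simp add: \<Psi>_def p_def N0_def)
  also have "\<dots> \<le> \<Psi> t1 y1" by (rule max [OF Y(2)])
  finally have big: "c + 2 * \<delta> \<le> \<Psi> t1 y1" using \<delta> by simp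
  \<comment> \<open>The maximum is attained neither at the ends of the interval, where
    \<open>u\<close> is at most \<open>c\<close>, nor on the level \<open>R\<close>. So there is
    room for a small disc around it.\<close>
  have t1: "0 < t1" "t1 < 1"
  proof -
    have "t1 \<notin> {0, 1}"
    proof
      assume t1: "t1 \<in> {0, 1}"
      then have "u (A *v y1) \<le> c" using bd z by (auto simp: Y_def N_def)
      moreover have "\<delta> * t1\<^sup>2 \<le> \<delta>" using t1 \<delta> by auto
      moreover have "k * p (N t1 y1) \<ge> 0" using k p0 by simp
      ultimately show False using big \<delta> unfolding \<Psi>_def by linarith
    qed
    then show "0 < t1" "t1 < 1" using z by (auto simp: Y_def)
  qed
  have N1: "N t1 y1 < R"
  proof (rule ccontr)
    assume "\<not> N t1 y1 < R"
    then have "N t1 y1 = R" using z by (auto simp: Y_def)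
    then have "k * p (N t1 y1) = m" using N0 by (simp add: p_def k_def)
    moreover have "\<delta> * t1\<^sup>2 \<le> \<delta>" using t1 \<delta> by (simp add: power_le_one mult_left_le)
    moreover have "u (A *v y1) \<le> B" using B z by blast
    ultimately have "\<Psi> t1 y1 \<le> B + \<delta> - m" by (simp add: \<Psi>_def)
    then show False using big \<delta> unfolding m_def by linarith
  qed
  obtain Q C \<epsilon> where Q: "Q \<ge> 0" "C \<ge> 0" "\<epsilon> > 0"
    and tangent: "\<And>\<sigma>. cmod \<sigma> \<le> \<epsilon> \<Longrightarrow> \<bar>ellnorm l (t1 + Re \<sigma>) (tangent l y1 \<sigma>) - ellnorm l t1 y1 + Re (\<sigma>\<^sup>2) * Q\<bar> \<le> C * cmod \<sigma> ^ 3"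
    using ellnorm_tangent by metis
  \<comment> \<open>\<open>2 * h\<close> is the slope of the penalty at the maximum, and
    \<open>K\<close> bounds the coefficient of the total cubic error.\<close>
  define h where "h = max 0 (N t1 y1 - N0)"
  define K where "K = k * (2 * h * C + (Q + C)\<^sup>2)"
  have h: "h \<ge> 0" by (simp add: h_def)
  have K: "K \<ge> 0" using k h Q by (simp add: K_def)
  have "0 < (R - N t1 y1) / (Q + C + 1)" "0 < \<delta> / (2 * (K + 1))"
    using Q N1 K \<delta> by simp_all
  \<comment> \<open>The radius \<open>s\<close> is so small that the tangent disc stays in
    \<open>Y\<close> and that \<open>K * s\<close> is less than \<open>\<delta> / 2\<close>.\<close>
  then obtain s where "0 < s"
    "s < min (min (min 1 \<epsilon>) (min t1 (1 - t1))) (min ((R - N t1 y1) / (Q + C + 1)) (\<delta> / (2 * (K + 1))))"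
    using dense [of 0 "min (min (min 1 \<epsilon>) (min t1 (1 - t1))) (min ((R - N t1 y1) / (Q + C + 1)) (\<delta> / (2 * (K + 1))))"]
      Q t1 by auto
  then have s: "0 < s" "s \<le> 1" "s \<le> \<epsilon>" "s \<le> t1" "s \<le> 1 - t1"
    "s \<le> (R - N t1 y1) / (Q + C + 1)" "s < \<delta> / (2 * (K + 1))"
    by simp_all
  have dN: "\<bar>N (t1 + Re \<sigma>) (tangent l y1 \<sigma>) - N t1 y1\<bar> \<le> (Q + C) * s\<^sup>2" 
    and dN': "N (t1 + Re \<sigma>) (tangent l y1 \<sigma>) - N t1 y1 \<le> - Re (\<sigma>\<^sup>2) * Q + C * s ^ 3"
    if \<sigma>: "cmod \<sigma> \<le> s" for \<sigma>
  proof -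
    have "C * cmod \<sigma> ^ 3 \<le> C * s ^ 3" using Q \<sigma> by (intro mult_left_mono power_mono) auto
    moreover have "C * s ^ 3 \<le> C * s\<^sup>2" using Q s by (intro mult_left_mono power_decreasing) auto
    moreover have "\<bar>Re (\<sigma>\<^sup>2) * Q\<bar> \<le> s\<^sup>2 * Q"
    proof -
      have "\<bar>Re (\<sigma>\<^sup>2)\<bar> \<le> (cmod \<sigma>)\<^sup>2" using abs_Re_le_cmod [of "\<sigma>\<^sup>2"] by (simp add: norm_power)
      also have "\<dots> \<le> s\<^sup>2" using \<sigma> by (intro power_mono) auto
      finally show ?thesis using Q by (simp add: abs_mult mult_right_mono)
    qed
    moreover have "\<bar>N (t1 + Re \<sigma>) (tangent l y1 \<sigma>) - N t1 y1 + Re (\<sigma>\<^sup>2) * Q\<bar> \<le> C * cmod \<sigma> ^ 3"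
      using tangent [of \<sigma>] \<sigma> s by (simp add: N_def)
    ultimately show "\<bar>N (t1 + Re \<sigma>) (tangent l y1 \<sigma>) - N t1 y1\<bar> \<le> (Q + C) * s\<^sup>2"
      "N (t1 + Re \<sigma>) (tangent l y1 \<sigma>) - N t1 y1 \<le> - Re (\<sigma>\<^sup>2) * Q + C * s ^ 3"
      by (simp_all add: algebra_simps)
  qed
  have inY: "(t1 + Re \<sigma>, tangent l y1 \<sigma>) \<in> Y" if \<sigma>: "cmod \<sigma> \<le> s" for \<sigma>
  proof -
    have "(Q + C) * s\<^sup>2 \<le> (Q + C) * s"
      using s Q by (intro mult_left_mono) (auto simp: power2_eq_square mult_left_le_one_le)
    also have "\<dots> \<le> (Q + C + 1) * s" using s by simp
    also have "\<dots> \<le> R - N t1 y1" using s(6) Q by (simp add: field_simps)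
    finally have "N (t1 + Re \<sigma>) (tangent l y1 \<sigma>) \<le> R" using dN [OF \<sigma>] by linarith
    moreover have "\<bar>Re \<sigma>\<bar> \<le> s" using abs_Re_le_cmod [of \<sigma>] \<sigma> by linarith
    ultimately show ?thesis using s unfolding Y_def by auto
  qed
  define v where "v = A *v y1"
  define w where "w = A *v (\<chi> i. of_real (l i) * y1 $ i)"
  have line: "A *v tangent l y1 \<sigma> = v + \<sigma> *s w" for \<sigma>
  proof -
    have "tangent l y1 \<sigma> = y1 + \<sigma> *s (\<chi> i. of_real (l i) * y1 $ i)"
      by (simp add: tangent_def vec_eq_iff algebra_simps)
    then show ?thesis by (simp add: v_def w_def vec.add vec.scale)
  qed
  have p_le: "p (x + e) \<le> p x + 2 * max 0 (x - N0) * e + e\<^sup>2" for x e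
  proof (cases "x \<ge> N0")
    case True
    have "p (x + e) \<le> (x + e - N0)\<^sup>2" by (auto simp: p_def max_def)
    also have "\<dots> = p x + 2 * max 0 (x - N0) * e + e\<^sup>2"
      using True by (simp add: p_def power2_eq_square algebra_simps)
    finally show ?thesis .
  next
    case False
    then have "max 0 (x + e - N0) \<le> \<bar>e\<bar>" by auto
    then have "p (x + e) \<le> e\<^sup>2"
      unfolding p_def using power_mono [of "max 0 (x + e - N0)" "\<bar>e\<bar>" 2] by simp
    then show ?thesis using False by (simp add: p_def)
  qed
  \<comment> \<open>Maximality of \<open>\<Psi>\<close> bounds \<open>u\<close> on the circle. By
    \<open>2 * (cos \<theta>)\<^sup>2 = 1 + cos (2 * \<theta>)\<close> the mean of
    \<open>\<delta> * t\<^sup>2\<close> exceeds its central value by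
    \<open>\<delta> * s\<^sup>2 / 2\<close>, while the quadratic part of the penalty is a multiple
    of \<open>cos (2 * \<theta>)\<close>.\<close>
  have "u (v + 0 *s w) \<le> u v - \<delta> * s\<^sup>2 / 2 + K * s ^ 3"
  proof (rule submean_trigonometric_bound)
    show "subharmonic_on {\<tau>. v + \<tau> *s w \<in> \<Omega>} (\<lambda>\<tau>. u (v + \<tau> *s w))"
      using psh by (simp add: plurisubharmonic_on_def)
    show "0 < s" by (rule s)
    show "cball 0 s \<subseteq> {\<tau>. v + \<tau> *s w \<in> \<Omega>}"
    proof
      fix \<tau> :: complex assume "\<tau> \<in> cball 0 s"
      then have "(t1 + Re \<tau>, tangent l y1 \<tau>) \<in> Y" by (intro inY) simp
      then show "\<tau> \<in> {\<tau>. v + \<tau> *s w \<in> \<Omega>}"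
        unfolding line [symmetric] using sub by (auto simp: Y_def N_def)
    qed
    fix \<theta>
    define \<sigma> where "\<sigma> = of_real s * cis \<theta>"
    have \<sigma>: "cmod \<sigma> = s" "Re \<sigma> = s * cos \<theta>"
      using s by (simp_all add: \<sigma>_def norm_mult)
    have \<sigma>2: "Re (\<sigma>\<^sup>2) = s\<^sup>2 * cos (2 * \<theta>)"
      by (simp add: \<sigma>_def Re_power2 cos_double power_mult_distrib right_diff_distrib)
    have \<sigma>s: "cmod \<sigma> \<le> s" using \<sigma> by simp
    define e where "e = N (t1 + Re \<sigma>) (tangent l y1 \<sigma>) - N t1 y1"
    have "u (v + \<sigma> *s w) + \<delta> * (t1 + s * cos \<theta>)\<^sup>2 - k * p (N t1 y1 + e) \<le> u v + \<delta> * t1\<^sup>2 - k * p (N t1 y1)"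
      using max [OF inY [OF \<sigma>s]] by (simp add: \<Psi>_def line \<sigma> e_def v_def)
    moreover have "k * p (N t1 y1 + e) \<le> k * (p (N t1 y1) + 2 * h * e + e\<^sup>2)"
      using p_le k unfolding h_def by (intro mult_left_mono) auto
    moreover have "2 * h * e + e\<^sup>2 \<le> 2 * h * (- s\<^sup>2 * cos (2 * \<theta>) * Q) + (2 * h * C + (Q + C)\<^sup>2) * s ^ 3"
    proof -
      have "2 * h * e \<le> 2 * h * (- Re (\<sigma>\<^sup>2) * Q + C * s ^ 3)"
        using dN' [OF \<sigma>s] h by (intro mult_left_mono) (auto simp: e_def)
      moreover have "e\<^sup>2 \<le> (Q + C)\<^sup>2 * s ^ 3"
      proof -
        have "e\<^sup>2 \<le> ((Q + C) * s\<^sup>2)\<^sup>2"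
          using dN [OF \<sigma>s] by (intro power2_le_iff_abs_le [THEN iffD2]) (auto simp: e_def)
        also have "\<dots> = (Q + C)\<^sup>2 * s ^ 4" by (simp add: power_mult_distrib)
        also have "\<dots> \<le> (Q + C)\<^sup>2 * s ^ 3"
          using s by (intro mult_left_mono power_decreasing) auto
        finally show ?thesis .
      qed
      ultimately show ?thesis unfolding \<sigma>2 by (simp add: algebra_simps)
    qed
    then have "k * (2 * h * e + e\<^sup>2) \<le> k * (2 * h * (- s\<^sup>2 * cos (2 * \<theta>) * Q) + (2 * h * C + (Q + C)\<^sup>2) * s ^ 3)"
      using k by (intro mult_left_mono) auto
    moreover have "(t1 + s * cos \<theta>)\<^sup>2 = t1\<^sup>2 + 2 * t1 * s * cos \<theta> + s\<^sup>2 / 2 + s\<^sup>2 / 2 * cos (2 * \<theta>)"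
      unfolding cos_double_cos by (simp add: power2_eq_square algebra_simps)
    ultimately have "u (v + \<sigma> *s w) \<le> u v - \<delta> * s\<^sup>2 / 2 + K * s ^ 3 + (- 2 * \<delta> * t1 * s) * cos \<theta>
        + (- \<delta> * s\<^sup>2 / 2 - 2 * k * h * s\<^sup>2 * Q) * cos (2 * \<theta>)"
      unfolding K_def by (simp add: algebra_simps)
    then show "u (v + (of_real s * cis \<theta>) *s w) \<le> u v - \<delta> * s\<^sup>2 / 2 + K * s ^ 3 + (- 2 * \<delta> * t1 * s) * cos \<theta>
        + (- \<delta> * s\<^sup>2 / 2 - 2 * k * h * s\<^sup>2 * Q) * cos (2 * \<theta>)"
      by (simp add: \<sigma>_def)
  qed
  then have "\<delta> / 2 * s\<^sup>2 \<le> (K * s) * s\<^sup>2" by (simp add: power2_eq_square power3_eq_cube)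
  then have "\<delta> / 2 \<le> K * s" using s by simp
  also have "K * s \<le> (K + 1) * s" using s by simp
  also have "\<dots> < \<delta> / 2" using s(7) K by (simp add: field_simps)
  finally show False by simp
qed

text \<open>A point outside \<open>\<Omega>\<close> minimizing \<open>ellnorm\<close> would be a limit of points at which the exhaustion function is
  bounded by its maximum over the two end ellipsoids.\<close>

lemma pseudoconvex_interpolation:
  fixes A :: "complex ^ 'n ^ 'n"
  assumes pc: "pseudoconvex \<Omega>"
    and E0: "\<And>y. ellnorm l 0 y < 1 \<Longrightarrow> A *v y \<in> \<Omega>" and E1: "\<And>y. ellnorm l 1 y < 1 \<Longrightarrow> A *v y \<in> \<Omega>"
    and t: "t \<in> {0..1}" and y: "ellnorm l t y < 1"
  shows "A *v y \<in> \<Omega>"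
proof (rule ccontr)
  assume out: "A *v y \<notin> \<Omega>"
  obtain u where op: "open \<Omega>" and cont: "continuous_on \<Omega> u" and psh: "plurisubharmonic_on \<Omega> u"
    and exh: "\<And>c. compact {\<zeta> \<in> \<Omega>. u \<zeta> \<le> c}"
    using pc unfolding pseudoconvex_def by blast
  define R where "R = ellnorm l t y"
  have R: "R < 1" "R \<ge> 0" using y by (simp_all add: R_def ellnorm_nonneg)
  define Y where "Y = {(t, y). t \<in> {0..1} \<and> ellnorm l t y \<le> R}"
  have Y: "compact Y" unfolding Y_def by (rule compact_ellnorm)
  have contA: "continuous_on S (\<lambda>x. A *v snd x)" for S :: "(real \<times> (complex ^ 'n)) set"
    unfolding matrix_vector_mult_def by (intro continuous_intros)
  define Bad where "Bad = Y \<inter> (\<lambda>x. A *v snd x) -` (- \<Omega>)"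
  have "compact Bad"
  proof -
    have "closed ((\<lambda>x :: real \<times> (complex ^ 'n). A *v snd x) -` (- \<Omega>))"
      using op contA by (intro closed_vimage) auto
    then show ?thesis unfolding Bad_def using Y by (rule compact_Int_closed [rotated])
  qed
  moreover have "(t, y) \<in> Bad" using t out by (simp add: Bad_def Y_def R_def)
  moreover have "continuous_on Bad (\<lambda>x. ellnorm l (fst x) (snd x))" by (intro continuous_intros)
  ultimately obtain z where z: "z \<in> Bad" and zmin: "\<And>x. x \<in> Bad \<Longrightarrow> ellnorm l (fst z) (snd z) \<le> ellnorm l (fst x) (snd x)"
    using continuous_attains_inf [of Bad "\<lambda>x. ellnorm l (fst x) (snd x)"] by blast
  define t1 y1 where "t1 = fst z" and "y1 = snd z"
  have z': "t1 \<in> {0..1}" "ellnorm l t1 y1 \<le> R" "A *v y1 \<notin> \<Omega>"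
    using z by (auto simp: Bad_def Y_def t1_def y1_def)
  have inside: "A *v x \<in> \<Omega>" if "s \<in> {0..1}" "ellnorm l s x < ellnorm l t1 y1" for s x
    using zmin [of "(s, x)"] that z' by (auto simp: Bad_def Y_def t1_def y1_def)
  have "0 \<in> \<Omega>" using E0 [of 0] by (simp add: ellnorm_def)
  then have "y1 \<noteq> 0" using z' by auto
  then have N1: "ellnorm l t1 y1 > 0"
    using ellnorm_nonneg [of l t1 y1] ellnorm_eq_0 [of l t1 y1] by linarith
  \<comment> \<open>The two end ellipsoids, shrunk to the level \<open>R < 1\<close>, are compact
    subsets of the domain after applying \<open>A\<close>, so \<open>u\<close> has a maximum
    \<open>c\<close> there.\<close>
  define Y0 where "Y0 = Y \<inter> {x. fst x \<in> {0, 1}}"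
  have Y0\<Omega>: "A *v snd x \<in> \<Omega>" if "x \<in> Y0" for x
    using that E0 E1 R by (auto simp: Y0_def Y_def)
  have "compact Y0"
    unfolding Y0_def
  proof (intro compact_Int_closed Y)
    have "closed (fst -` {0, 1::real} :: (real \<times> (complex ^ 'n)) set)"
      by (intro closed_vimage continuous_intros)
    then show "closed {x :: real \<times> (complex ^ 'n). fst x \<in> {0, 1}}" by (simp add: vimage_def)
  qed
  moreover have "(0, 0) \<in> Y0" using R by (simp add: Y0_def Y_def ellnorm_def)
  moreover have "continuous_on Y0 (\<lambda>x. u (A *v snd x))"
    by (rule continuous_on_compose2 [OF cont contA]) (use Y0\<Omega> in auto)
  ultimately have "\<exists>x0\<in>Y0. \<forall>x\<in>Y0. u (A *v snd x) \<le> u (A *v snd x0)"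
    by (intro continuous_attains_sup) auto
  then obtain x0 :: "real \<times> (complex ^ 'n)" where x0: "\<And>x. x \<in> Y0 \<Longrightarrow> u (A *v snd x) \<le> u (A *v snd x0)"
    by blast
  define c where "c = u (A *v snd x0)"
  have c: "u (A *v x) \<le> c" if "s \<in> {0, 1}" "ellnorm l s x \<le> R" for s x
    using x0 [of "(s, x)"] that by (auto simp: c_def Y0_def Y_def)
  have near: "A *v (r *\<^sub>R y1) \<in> {\<zeta> \<in> \<Omega>. u \<zeta> \<le> c}" if r: "0 \<le> r" "r < 1" for r
  proof -
    have "r\<^sup>2 < 1" using r by (simp add: abs_square_less_1)
    then have less: "ellnorm l t1 (r *\<^sub>R y1) < ellnorm l t1 y1"
      using N1 by (simp add: ellnorm_scaleR)
    \<comment> \<open>Below the minimal bad level everything is inside \<open>\<Omega>\<close>, so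
      the maximum principle applies up to an intermediate level \<open>R'\<close>.\<close>
    then obtain R' where R': "ellnorm l t1 (r *\<^sub>R y1) < R'" "R' < ellnorm l t1 y1"
      using dense by blast
    have "u (A *v (r *\<^sub>R y1)) \<le> c"
    proof (rule max_principle_ellipsoids [OF cont psh _ _ z'(1) R'(1)])
      show "A *v x \<in> \<Omega>" if "s \<in> {0..1}" "ellnorm l s x \<le> R'" for s x
        using inside that R' by auto
      show "u (A *v x) \<le> c" if "s \<in> {0, 1}" "ellnorm l s x \<le> R'" for s x
        using c that R' z'(2) by auto
    qed
    with inside [OF z'(1) less] show ?thesis by simp
  qed
  \<comment> \<open>As \<open>r\<close> tends to 1 the limit stays in the compact sublevel set,
    hence in \<open>\<Omega>\<close>, although \<open>A *v y1\<close> was chosen outside.\<close>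
  have "((\<lambda>r. A *v (r *\<^sub>R y1)) \<longlongrightarrow> A *v (1 *\<^sub>R y1)) (at_left 1)"
    unfolding matrix_vector_mult_def by (intro tendsto_intros)
  moreover have "\<forall>\<^sub>F r in at_left (1::real). A *v (r *\<^sub>R y1) \<in> {\<zeta> \<in> \<Omega>. u \<zeta> \<le> c}"
    using eventually_at_left_real [of 0 1] by (rule eventually_mono) (use near in auto)
  ultimately have "A *v (1 *\<^sub>R y1) \<in> {\<zeta> \<in> \<Omega>. u \<zeta> \<le> c}"
    by (intro Lim_in_closed_set [OF compact_imp_closed [OF exh]]) auto
  with z' show False by simp
qed

section \<open>Ellipsoids of maximal volume\<close>

lemma continuous_on_det [continuous_intros]:
  fixes f :: "'a::topological_space \<Rightarrow> complex ^ 'n ^ 'n"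
  assumes "continuous_on S f"
  shows "continuous_on S (\<lambda>x. det (f x))"
  unfolding det_def using assms by (intro continuous_intros)

text \<open>Column \<open>j\<close> of \<open>M\<close> is twice the image of
  \<open>axis j (1/2)\<close>, a point of the open ball, and that image lies in the bounded set
  \<open>\<Omega>\<close>.\<close>

lemma bounded_ball_maps:
  assumes "bounded \<Omega>"
  shows "bounded {M :: complex ^ 'n ^ 'n. (*v) M ` ball 0 1 \<subseteq> \<Omega>}"
proof -
  obtain r where r: "\<And>z. z \<in> \<Omega> \<Longrightarrow> norm z \<le> r"
    using assms by (auto simp: bounded_iff)
  have "norm M \<le> (\<Sum>i\<in>(UNIV :: 'n set). \<Sum>j\<in>(UNIV :: 'n set). 2 * r)" if M: "(*v) M ` ball 0 1 \<subseteq> \<Omega>" for M :: "complex ^ 'n ^ 'n"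
  proof -
    have entry: "norm (M $ i $ j) \<le> 2 * r" for i j
    proof -
      have "norm (axis j (1/2) :: complex ^ 'n) = 1/2"
        by (simp add: norm_eq_sqrt_inner inner_axis_axis) (simp add: inner_complex_def real_sqrt_divide)
      then have "M *v axis j (1/2) \<in> \<Omega>" by (intro subsetD [OF M] imageI) simp
      then have "norm (M *v axis j (1/2)) \<le> r" by (rule r)
      then have "norm ((M *v axis j (1/2)) $ i) \<le> r" by (rule order_trans [OF Finite_Cartesian_Product.norm_nth_le])
      moreover have "axis j (1/2) = (1/2) *s (axis j 1 :: complex ^ 'n)"
        by (simp add: axis_def vec_eq_iff)
      moreover have "(M *v axis j 1) $ i = M $ i $ j"
        by (simp add: matrix_vector_mult_def axis_def if_distrib [of "\<lambda>x. _ * x"] cong: if_cong)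
      ultimately show ?thesis
        by (simp add: vec.scale norm_divide)
    qed
    have "norm M \<le> (\<Sum>i\<in>UNIV. norm (M $ i))"
      unfolding norm_vec_def [of M] by (rule L2_set_le_sum) simp
    also have "\<dots> \<le> (\<Sum>i\<in>UNIV. \<Sum>j\<in>UNIV. norm (M $ i $ j))"
      by (intro sum_mono) (simp only: norm_vec_def, rule L2_set_le_sum, simp)
    also have "\<dots> \<le> (\<Sum>i\<in>(UNIV :: 'n set). \<Sum>j\<in>(UNIV :: 'n set). 2 * r)"
      by (intro sum_mono entry)
    finally show ?thesis .
  qed
  then show ?thesis by (auto simp: bounded_iff)
qed

text \<open>By Cramer's rule \<open>w\<close> below depends continuously on the matrix, so every point of \<open>T B\<close> lies in the
  ellipsoids \<open>M B\<close> for matrices \<open>M\<close> close to \<open>T\<close>.\<close>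

lemma closure_ball_maps:
  fixes T :: "complex ^ 'n ^ 'n"
  assumes T: "T \<in> closure {M. (*v) M ` ball 0 1 \<subseteq> \<Omega>}" and inv: "det T \<noteq> 0"
  shows "(*v) T ` ball 0 1 \<subseteq> \<Omega>"
proof
  fix z assume "z \<in> (*v) T ` ball 0 1"
  then obtain v where v: "v \<in> ball 0 1" and z: "z = T *v v" by blast
  obtain X where X: "\<And>n. (*v) (X n) ` ball 0 1 \<subseteq> \<Omega>" and lim: "X \<longlonglongrightarrow> T"
    using T by (auto simp: closure_sequential)
  define w where "w M = (\<chi> k. det (\<chi> i j. if j = k then z $ i else M $ i $ j) / det M)" for M :: "complex ^ 'n ^ 'n"
  have w: "M *v w M = z" if "det M \<noteq> 0" for M
    using cramer [OF that, of "w M" z] by (simp add: w_def)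
  have "w T = v" using cramer [OF inv, of v z] by (simp add: w_def z)
  have "open {M :: complex ^ 'n ^ 'n. det M \<noteq> 0}"
    by (intro open_Collect_neq continuous_intros)
  moreover have "continuous_on {M. det M \<noteq> 0} w"
  proof -
    have "continuous_on S (\<lambda>M :: complex ^ 'n ^ 'n. if j = k then z $ i else M $ i $ j)" for S i j k
      by (cases "j = k") (auto intro!: continuous_intros)
    then show ?thesis unfolding w_def by (intro continuous_intros) auto
  qed
  ultimately have "isCont w T" using inv by (simp add: continuous_on_eq_continuous_at)
  from isCont_tendsto_compose [OF this lim] have "(\<lambda>n. w (X n)) \<longlonglongrightarrow> v"
    unfolding \<open>w T = v\<close> .
  then have "\<forall>\<^sub>F n in sequentially. w (X n) \<in> ball 0 1"
    using v by (intro topological_tendstoD) auto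
  moreover have "\<forall>\<^sub>F n in sequentially. X n \<in> {M. det M \<noteq> 0}"
    using inv by (intro topological_tendstoD [OF lim] \<open>open {M. det M \<noteq> 0}\<close>) simp
  ultimately have "\<forall>\<^sub>F n in sequentially. z \<in> \<Omega>"
  proof eventually_elim
    case (elim n)
    then have "z = X n *v w (X n)" by (simp add: w)
    then show ?case using X [of n] elim by blast
  qed
  then show "z \<in> \<Omega>" by simp
qed

lemma max_volume_ellipsoid_matrix:
  fixes T :: "complex ^ 'n ^ 'n"
  assumes T: "invertible T" "(*v) T ` ball 0 1 \<subseteq> \<Omega>"
  shows "max_volume_ellipsoid \<Omega> ((*v) T ` ball 0 1) \<longleftrightarrow>
    (\<forall>M :: complex ^ 'n ^ 'n. invertible M \<longrightarrow> (*v) M ` ball 0 1 \<subseteq> \<Omega> \<longrightarrow> cmod (det M) \<le> cmod (det T))"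
proof -
  have vol: "measure lebesgue ((*v) M ` ball 0 1) \<le> measure lebesgue ((*v) T ` ball 0 1) \<longleftrightarrow> cmod (det M) \<le> cmod (det T)"
    if "invertible M" for M :: "complex ^ 'n ^ 'n"
    using measure_ball_pos [where 'n = 'n]
    unfolding measure_matrix_ball [OF that] measure_matrix_ball [OF T(1)] by (simp add: abs_le_square_iff [symmetric])
  have "(*v) T ` ball 0 1 \<in> hermitian_ellipsoids"
    unfolding hermitian_ellipsoid_iff by (rule exI [of _ T]) (simp add: T)
  then have "max_volume_ellipsoid \<Omega> ((*v) T ` ball 0 1) \<longleftrightarrow>
      (\<forall>E\<in>hermitian_ellipsoids. E \<subseteq> \<Omega> \<longrightarrow> measure lebesgue E \<le> measure lebesgue ((*v) T ` ball 0 1))"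
    using T(2) by (simp add: max_volume_ellipsoid_def)
  also have "\<dots> \<longleftrightarrow> (\<forall>M :: complex ^ 'n ^ 'n. invertible M \<longrightarrow> (*v) M ` ball 0 1 \<subseteq> \<Omega> \<longrightarrow>
      measure lebesgue ((*v) M ` ball 0 1) \<le> measure lebesgue ((*v) T ` ball 0 1))"
    unfolding Ball_def hermitian_ellipsoid_iff by blast
  also have "\<dots> \<longleftrightarrow> (\<forall>M :: complex ^ 'n ^ 'n. invertible M \<longrightarrow> (*v) M ` ball 0 1 \<subseteq> \<Omega> \<longrightarrow> cmod (det M) \<le> cmod (det T))"
    by (simp only: vol cong: imp_cong)
  finally show ?thesis .
qed

text \<open>The closure of the admissible matrices may contain singular ones. A maximizer of the
  determinant is not singular, since a small ball already gives a positive value, and so it is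
  admissible itself by \<open>closure_ball_maps\<close>.\<close>

lemma exists_max_volume_ellipsoid:
  fixes \<Omega> :: "(complex ^ 'n) set"
  assumes "open \<Omega>" "bounded \<Omega>" "0 \<in> \<Omega>"
  shows "\<exists>E. max_volume_ellipsoid \<Omega> E"
proof -
  let ?S = "{M :: complex ^ 'n ^ 'n. (*v) M ` ball 0 1 \<subseteq> \<Omega>}"
  obtain e where e: "e > 0" "ball 0 e \<subseteq> \<Omega>" using assms openE by blast
  define M0 :: "complex ^ 'n ^ 'n" where "M0 = diagm (\<lambda>i. e)"
  have "M0 *v v = e *\<^sub>R v" for v by (simp add: M0_def vec_eq_iff) (simp add: scaleR_conv_of_real)
  then have M0: "M0 \<in> ?S" using e by (auto intro!: subsetD [OF e(2)])
  have "compact (closure ?S)"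
    using bounded_ball_maps [OF assms(2)] by (simp add: compact_closure)
  moreover have "closure ?S \<noteq> {}" using M0 by auto
  moreover have "continuous_on (closure ?S) (\<lambda>M. cmod (det M))" by (intro continuous_intros)
  ultimately obtain T where T: "T \<in> closure ?S" and max: "\<And>M. M \<in> closure ?S \<Longrightarrow> cmod (det M) \<le> cmod (det T)"
    using continuous_attains_sup [of "closure ?S" "\<lambda>M. cmod (det M)"] by blast
  have "0 < cmod (det M0)" using e by (simp add: M0_def det_diagm)
  also have "\<dots> \<le> cmod (det T)" by (rule max [OF subsetD [OF closure_subset M0]])
  finally have det: "det T \<noteq> 0" by simp
  then have inv: "invertible T" by (simp add: invertible_det_nz)
  have "cmod (det M) \<le> cmod (det T)" if M: "(*v) M ` ball 0 1 \<subseteq> \<Omega>" for M :: "complex ^ 'n ^ 'n"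
  proof (rule max)
    have "M \<in> ?S" using M by (rule CollectI)
    then show "M \<in> closure ?S" by (rule subsetD [OF closure_subset])
  qed
  then have "max_volume_ellipsoid \<Omega> ((*v) T ` ball 0 1)"
    unfolding max_volume_ellipsoid_matrix [OF inv closure_ball_maps [OF T det]] by blast
  then show ?thesis ..
qed

section \<open>Boundary points of ellipsoids and traces\<close>

lemma frontier_matrix_ball:
  fixes M :: "complex ^ 'n ^ 'n"
  assumes M: "invertible M"
  shows "M *v w \<in> frontier ((*v) M ` ball 0 1) \<longleftrightarrow> norm w = 1"
proof -
  have "closure ((*v) M ` ball 0 1) = (*v) M ` closure (ball 0 1)"
    by (rule closure_injective_linear_image [symmetric, OF linear_matrix inj_matrix [OF M]])
  then have "frontier ((*v) M ` ball 0 1) = (*v) M ` (cball 0 1 - ball 0 1)"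
    using matrix_image_ball(1) [OF M]
    by (simp add: frontier_def interior_open image_set_diff [OF inj_matrix [OF M]])
  then show ?thesis
    using inj_image_mem_iff [OF inj_matrix [OF M]] by auto
qed

lemma trace_diagm: "trace (diagm d) = of_real (\<Sum>i\<in>UNIV. d i)"
  by (simp add: trace_def diagm_def)

lemma trace_conjugate:
  fixes M A :: "complex ^ 'n ^ 'n"
  assumes "M' ** M = mat 1"
  shows "trace (M ** A ** M') = trace A"
proof -
  have "trace (M ** A ** M') = trace (M' ** (M ** A))" by (rule trace_mul_sym)
  also have "M' ** (M ** A) = A" by (simp add: matrix_mul_assoc assms)
  finally show ?thesis .
qed

lemma cdot_diagm: "cdot (diagm d *v w) w = of_real (\<Sum>i\<in>UNIV. d i * (cmod (w $ i))\<^sup>2)"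
  by (simp add: cdot_def complex_norm_square mult.assoc del: of_real_power)

section \<open>From the measure to maximal volume\<close>

text \<open>At \<open>t = 0\<close> the function \<open>ellnorm l t w\<close> has value
  \<open>(norm w)\<^sup>2\<close> and derivative minus twice the given sum, so it drops below
  1.\<close>

lemma quadratic_form_pos_enters_ellipsoids:
  assumes w: "norm w \<le> 1" and pos: "0 < (\<Sum>i\<in>UNIV. l i * (cmod (w $ i))\<^sup>2)"
  obtains t where "t \<in> {0..1}" "ellnorm l t w < 1"
proof -
  have "((\<lambda>t. ellnorm l t w) has_real_derivative (- 2 * (\<Sum>i\<in>UNIV. l i * (cmod (w $ i))\<^sup>2))) (at 0)"
    unfolding ellnorm_def sum_distrib_left
  proof (rule DERIV_sum)
    fix i
    show "((\<lambda>t. exp (- 2 * t * l i) * (cmod (w $ i))\<^sup>2) has_real_derivative - 2 * (l i * (cmod (w $ i))\<^sup>2)) (at 0)"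
      by (rule derivative_eq_intros refl | simp)+
  qed
  from DERIV_neg_dec_right [OF this] obtain d where d: "d > 0" "\<And>t. \<lbrakk>t > 0; t < d\<rbrakk> \<Longrightarrow> ellnorm l (0 + t) w < ellnorm l 0 w"
    using pos by auto
  have "ellnorm l 0 w = (norm w)\<^sup>2"
    by (simp add: ellnorm_def norm_vec_def L2_set_def sum_nonneg)
  also have "\<dots> \<le> 1" using w by (simp add: power_le_one)
  finally have "ellnorm l (min 1 (d / 2)) w < 1"
    using min.strict_coboundedI2 [of "d / 2" d 1] d(2) [of "min 1 (d / 2)"] d(1) by simp
  then show thesis using that [of "min 1 (d / 2)"] d(1) by simp
qed

lemma integral_pos_imp_exists_pos:
  fixes f :: "'a \<Rightarrow> complex"
  assumes "integrable \<mu> f" "Re (LINT z|\<mu>. f z) > 0"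
  obtains z where "z \<in> space \<mu>" "Re (f z) > 0"
proof (rule ccontr)
  assume "\<not> thesis"
  then have "Re (f z) \<le> 0" if "z \<in> space \<mu>" for z using that \<open>\<And>z. \<lbrakk>z \<in> space \<mu>; 0 < Re (f z)\<rbrakk> \<Longrightarrow> thesis\<close> by force
  then have "(LINT z|\<mu>. Re (f z)) \<le> (LINT z|\<mu>. 0)"
    using assms(1) by (intro integral_mono) auto
  then show False using assms by simp
qed

lemma ellipsoid_image_diagm:
  fixes A :: "complex ^ 'n ^ 'n"
  assumes "ellnorm l 1 y < 1"
  shows "A *v y \<in> (*v) (A ** diagm (\<lambda>i. exp (l i))) ` ball 0 1"
proof -
  define v where "v = (\<chi> i. y $ i / of_real (exp (l i)))"
  have "diagm (\<lambda>i. exp (l i)) *v v = y" by (simp add: v_def vec_eq_iff)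
  then have "A *v y = (A ** diagm (\<lambda>i. exp (l i))) *v v"
    by (simp add: matrix_vector_mul_assoc [symmetric])
  moreover have "v \<in> ball 0 1"
  proof -
    have "(cmod (v $ i))\<^sup>2 = exp (- 2 * 1 * l i) * (cmod (y $ i))\<^sup>2" for i
    proof -
      have "cmod (v $ i) = cmod (y $ i) / exp (l i)" by (simp add: v_def norm_divide)
      moreover have "exp (- 2 * 1 * l i) = 1 / (exp (l i))\<^sup>2"
        by (simp add: exp_minus inverse_eq_divide flip: exp_double)
      ultimately show ?thesis by (simp add: power_divide)
    qed
    then have "(norm v)\<^sup>2 = ellnorm l 1 y"
      by (simp add: ellnorm_def norm_vec_def L2_set_def sum_nonneg)
    then have "(norm v)\<^sup>2 < 1" using assms by simp
    then show ?thesis by (simp add: abs_square_less_1)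
  qed
  ultimately show ?thesis by blast
qed

lemma measure_imp_max_volume:
  fixes \<Omega> :: "(complex ^ 'n) set" and M :: "complex ^ 'n ^ 'n"
  assumes pc: "pseudoconvex \<Omega>" and M: "invertible M" "(*v) M ` ball 0 1 \<subseteq> \<Omega>"
    and h: "\<And>v w. h (M *v v) (M *v w) = cdot v w"
    and sets: "sets \<mu> = sets (restrict_space borel (frontier \<Omega> \<inter> frontier ((*v) M ` ball 0 1)))"
    and \<mu>: "\<And>T. clinear T \<Longrightarrow> integrable \<mu> (\<lambda>z. h (T z) z) \<and> (LINT z|\<mu>. h (T z) z) = ctrace T"
    and M': "invertible M'" "(*v) M' ` ball 0 1 \<subseteq> \<Omega>"
  shows "cmod (det M') \<le> cmod (det M)"
proof (rule ccontr)
  assume less: "\<not> cmod (det M') \<le> cmod (det M)"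
  obtain N where N: "M ** N = mat 1" "N ** M = mat 1" using M by (auto simp: invertible_def)
  \<comment> \<open>\<open>N ** M'\<close> describes the second ellipsoid in coordinates where the
    first is the unit ball. Its decomposition makes the second one diagonal without moving the
    ball.\<close>
  have "invertible (N ** M')"
    using N M'(1) by (intro invertible_mult) (auto simp: invertible_def)
  then obtain U V d where U: "unitary U" and V: "unitary V" and d: "\<forall>i. d i > 0" and NM': "N ** M' = U ** diagm d ** V"
    by (rule singular_value_decomposition)
  define A where "A = M ** U"
  define l where "l i = ln (d i)" for i
  have dl: "diagm d = diagm (\<lambda>i. exp (l i))" using d by (simp add: l_def)
  have "M' = M ** (N ** M')" by (simp add: matrix_mul_assoc N)
  then have M'_eq: "M' = A ** diagm d ** V" by (simp add: NM' A_def matrix_mul_assoc)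
  have A_inv: "invertible A" unfolding A_def by (intro invertible_mult M invertible_unitary U)
  have E: "(*v) A ` ball 0 1 = (*v) M ` ball 0 1"
  proof -
    have "(*v) A ` ball 0 1 = (*v) M ` (*v) U ` ball 0 1"
      by (simp add: A_def image_image matrix_vector_mul_assoc)
    then show ?thesis by (simp only: unitary_ball [OF U])
  qed
  have E': "(*v) (A ** diagm d) ` ball 0 1 \<subseteq> \<Omega>"
  proof -
    have "(*v) M' ` ball 0 1 = (*v) (A ** diagm d) ` (*v) V ` ball 0 1"
      by (simp add: M'_eq image_image matrix_vector_mul_assoc)
    then show ?thesis using M'(2) by (simp only: unitary_ball [OF V])
  qed
  have hA: "h (A *v v) (A *v w) = cdot v w" for v w
    by (simp add: A_def h cdot_unitary [OF U] matrix_vector_mul_assoc [symmetric])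
  have "0 < (\<Sum>i\<in>UNIV. l i)"
  proof -
    have "cmod (det M') = cmod (det M) * (\<Prod>i\<in>UNIV. d i)"
      using d by (simp add: M'_eq A_def det_mul norm_mult cmod_det_unitary U V det_diagm abs_of_pos flip: prod_norm)
    moreover have "cmod (det M) > 0" using M by (simp add: invertible_det_nz)
    ultimately have "1 < (\<Prod>i\<in>UNIV. d i)" using less by (simp add: not_le mult_less_cancel_left1)
    then have "0 < ln (\<Prod>i\<in>UNIV. d i)" by simp
    also have "\<dots> = (\<Sum>i\<in>UNIV. l i)"
      unfolding l_def using d by (intro ln_prod) (simp_all add: less_imp_neq [symmetric])
    finally show ?thesis .
  qed
  moreover obtain A' where A': "A ** A' = mat 1" "A' ** A = mat 1" using A_inv by (auto simp: invertible_def)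
  \<comment> \<open>The test operator is diagonal with entries \<open>l i\<close> in the coordinates
    given by \<open>A\<close>. Its trace is positive because the second ellipsoid is larger.\<close>
  define L where "L = A ** diagm l ** A'"
  have L: "clinear ((*v) L)" by (rule matrix_vector_mul_linear_gen)
  have "ctrace ((*v) L) = of_real (\<Sum>i\<in>UNIV. l i)"
    unfolding ctrace_def matrix_of_matrix_vector_mul L_def trace_conjugate [OF A'(2)] by (rule trace_diagm)
  ultimately have "Re (LINT z|\<mu>. h (L *v z) z) > 0" using \<mu> [OF L] by simp
  then obtain z where z: "z \<in> space \<mu>" "Re (h (L *v z) z) > 0"
    by (rule integral_pos_imp_exists_pos [OF conjunct1 [OF \<mu> [OF L]]])
  define w where "w = A' *v z"
  have zw: "z = A *v w" by (simp add: w_def matrix_vector_mul_assoc A')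
  have "space \<mu> = frontier \<Omega> \<inter> frontier ((*v) A ` ball 0 1)"
    using sets_eq_imp_space_eq [OF sets] by (simp add: space_restrict_space E)
  with z have front: "z \<in> frontier \<Omega>" "A *v w \<in> frontier ((*v) A ` ball 0 1)"
    by (simp_all add: zw)
  then have "norm w = 1" by (simp only: frontier_matrix_ball [OF A_inv])
  moreover have "L *v z = A *v (diagm l *v w)"
    by (simp add: L_def w_def matrix_vector_mul_assoc matrix_mul_assoc)
  then have "Re (h (L *v z) z) = (\<Sum>i\<in>UNIV. l i * (cmod (w $ i))\<^sup>2)"
    by (simp add: zw hA cdot_diagm)
  ultimately obtain t where t: "t \<in> {0..1}" "ellnorm l t w < 1"
    using z(2) quadratic_form_pos_enters_ellipsoids [of w l] by auto
  \<comment> \<open>Interpolation puts the contact point into \<open>\<Omega>\<close>, but it lies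
    on the frontier of this open set.\<close>
  have "A *v w \<in> \<Omega>"
  proof (rule pseudoconvex_interpolation [OF pc _ _ t])
    fix y assume "ellnorm l 0 y < 1"
    then have "(norm y)\<^sup>2 < 1" by (simp add: ellnorm_def norm_vec_def L2_set_def sum_nonneg)
    then have "A *v y \<in> (*v) A ` ball 0 1" by (simp add: abs_square_less_1)
    then show "A *v y \<in> \<Omega>" using E M by blast
  next
    fix y assume "ellnorm l 1 y < 1"
    from ellipsoid_image_diagm [OF this, of A] show "A *v y \<in> \<Omega>"
      using E' by (auto simp: dl)
  qed
  moreover have "open \<Omega>" using pc by (simp add: pseudoconvex_def)
  ultimately show False using front(1) by (simp add: zw frontier_def interior_open)
qed

section \<open>From maximal volume to a measure\<close>

definition outer :: "complex ^ 'n \<Rightarrow> complex ^ 'n ^ 'n" where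
  "outer z = (\<chi> i j. z $ i * cnj (z $ j))"

lemma trace_outer: "trace (A ** outer z) = cdot (A *v z) z"
  by (simp add: trace_def matrix_matrix_mult_def matrix_vector_mult_def outer_def cdot_def sum_distrib_right mult.assoc)

text \<open>The real inner product of matrices is the real part of the trace pairing, so a
  separating functional evaluated at \<open>outer z\<close> becomes a quadratic form in
  \<open>z\<close>.\<close>

lemma inner_outer: "inner A (outer z) = Re (cdot (adjm A *v z) z)"
proof -
  have "inner A (outer z) = (\<Sum>i\<in>UNIV. \<Sum>j\<in>UNIV. Re (cnj (A $ i $ j) * z $ i * cnj (z $ j)))"
    unfolding inner_vec_def by (simp add: outer_def inner_complex_def algebra_simps)
  also have "\<dots> = (\<Sum>j\<in>UNIV. \<Sum>i\<in>UNIV. Re (cnj (A $ i $ j) * z $ i * cnj (z $ j)))"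
    by (rule sum.swap)
  also have "\<dots> = Re (cdot (adjm A *v z) z)"
    by (simp only: cdot_def adjm_def matrix_vector_mult_def vec_lambda_beta sum_distrib_right Re_sum)
  finally show ?thesis .
qed

lemma trace_sum_scaleR:
  "trace (A ** (\<Sum>v\<in>S. u v *\<^sub>R v)) = (\<Sum>v\<in>S. of_real (u v) * trace (A ** v))" for A :: "complex ^ 'n ^ 'n"
proof (induction S rule: infinite_finite_induct)
  case (insert x S)
  have "trace (A ** (r *\<^sub>R B)) = of_real r * trace (A ** B)" for r and B :: "complex ^ 'n ^ 'n"
    by (simp add: trace_def matrix_matrix_mult_def) (simp add: scaleR_conv_of_real sum_distrib_left mult_ac)
  then show ?case using insert by (simp add: matrix_add_ldistrib trace_add)
qed (simp_all add: trace_def)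

text \<open>The measure consists of finitely many point masses. At \<open>z = M *v w\<close> the
  integrand is the trace of a fixed matrix times \<open>outer w\<close>, hence linear in
  \<open>outer w\<close>, so the decomposition of the identity gives the integral.\<close>

lemma measure_from_trace_identity:
  fixes \<Omega> :: "(complex ^ 'n) set" and M :: "complex ^ 'n ^ 'n"
  assumes M: "invertible M" and h: "\<And>v w. h (M *v v) (M *v w) = cdot v w"
    and S: "finite S" "\<And>v. v \<in> S \<Longrightarrow> M *v \<zeta> v \<in> K" "\<And>v. v \<in> S \<Longrightarrow> outer (\<zeta> v) = v"
    and c: "\<And>v. v \<in> S \<Longrightarrow> 0 \<le> c v" "(\<Sum>v\<in>S. c v *\<^sub>R v) = mat 1"
  shows "\<exists>\<mu>. sets \<mu> = sets (restrict_space borel K) \<and>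
    (\<forall>T. clinear T \<longrightarrow> integrable \<mu> (\<lambda>z. h (T z) z) \<and> (LINT z|\<mu>. h (T z) z) = ctrace T)"
proof (intro exI conjI allI impI)
  define P where "P = point_measure S c"
  define g where "g v = M *v \<zeta> v" for v
  define \<mu> where "\<mu> = distr P (restrict_space borel K) g"
  show "sets \<mu> = sets (restrict_space borel K)" by (simp add: \<mu>_def)
  have g: "g \<in> measurable P (restrict_space borel K)"
    using S by (auto simp: P_def g_def space_restrict_space)
  fix T :: "complex ^ 'n \<Rightarrow> complex ^ 'n" assume T: "clinear T"
  define A where "A = matrix T"
  have TA: "T z = A *v z" for z by (simp add: A_def matrix_works [OF T])
  obtain N where N: "M ** N = mat 1" "N ** M = mat 1" using M by (auto simp: invertible_def)
  have hN: "h v w = cdot (N *v v) (N *v w)" for v w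
    using h [of "N *v v" "N *v w"] by (simp add: matrix_vector_mul_assoc N)
  have "continuous_on UNIV (\<lambda>z. h (T z) z)"
    unfolding hN TA cdot_def matrix_vector_mult_def by (intro continuous_intros)
  then have f: "(\<lambda>z. h (T z) z) \<in> borel_measurable (restrict_space borel K)"
    by (intro measurable_restrict_space1 borel_measurable_continuous_onI)
  show "integrable \<mu> (\<lambda>z. h (T z) z)"
    unfolding \<mu>_def integrable_distr_eq [OF g f] unfolding P_def using S(1) by (rule integrable_point_measure_finite)
  have "(LINT z|\<mu>. h (T z) z) = (\<Sum>v\<in>S. c v *\<^sub>R h (T (g v)) (g v))"
    unfolding \<mu>_def integral_distr [OF g f] unfolding P_def
    using S(1) c(1) by (rule lebesgue_integral_point_measure_finite)
  also have "\<dots> = (\<Sum>v\<in>S. of_real (c v) * trace ((N ** A ** M) ** v))"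
  proof (rule sum.cong [OF refl])
    fix v assume v: "v \<in> S"
    have "h (T (g v)) (g v) = cdot ((N ** A ** M) *v \<zeta> v) (\<zeta> v)"
      by (simp add: TA hN g_def matrix_vector_mul_assoc matrix_mul_assoc N)
    then show "c v *\<^sub>R h (T (g v)) (g v) = of_real (c v) * trace ((N ** A ** M) ** v)"
      using S(3) [OF v] trace_outer [of "N ** A ** M" "\<zeta> v"] by (simp add: scaleR_conv_of_real)
  qed
  also have "\<dots> = trace (N ** A ** M)"
    unfolding trace_sum_scaleR [symmetric] c(2) by simp
  also have "\<dots> = ctrace T"
    unfolding trace_conjugate [OF N(1)] ctrace_def A_def ..
  finally show "(LINT z|\<mu>. h (T z) z) = ctrace T" .
qed

text \<open>With \<open>d i = 1 + t * e i\<close> the product grows to first order in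
  \<open>t\<close>. If the ellipsoids left \<open>\<Omega>\<close> for all small \<open>t\<close>,
  exit points would accumulate at a contact point; near it the negative form makes
  \<open>diagm d\<close> shrink norms, so the exit points would lie in the original
  ellipsoid.\<close>

lemma enlarged_ellipsoid:
  fixes \<Omega> :: "(complex ^ 'n) set" and A :: "complex ^ 'n ^ 'n"
  assumes \<Omega>: "open \<Omega>" and A: "(*v) A ` ball 0 1 \<subseteq> \<Omega>"
    and neg: "\<And>w. \<lbrakk>norm w = 1; A *v w \<in> frontier \<Omega>\<rbrakk> \<Longrightarrow> (\<Sum>i\<in>UNIV. e i * (cmod (w $ i))\<^sup>2) < 0"
    and pos: "0 < (\<Sum>i\<in>UNIV. e i)"
  obtains d where "\<And>i. d i > 0" "1 < (\<Prod>i\<in>UNIV. d i)" "(*v) (A ** diagm d) ` ball 0 1 \<subseteq> \<Omega>"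
proof (rule ccontr)
  assume none: "\<not> thesis"
  define d where "d t i = 1 + t * e i" for t i
  have sq: "(norm w)\<^sup>2 = (\<Sum>i\<in>UNIV. (cmod (w $ i))\<^sup>2)" for w :: "complex ^ 'n"
    by (simp add: norm_vec_def L2_set_def sum_nonneg)
  have "((\<lambda>t. \<Prod>i\<in>UNIV. d t i) has_real_derivative (\<Sum>i\<in>UNIV. e i)) (at 0)"
    unfolding d_def
    by (rule has_field_derivative_prod' [THEN DERIV_cong]) (auto intro!: derivative_eq_intros)
  from DERIV_pos_inc_right [OF this pos] obtain \<delta> where \<delta>: "\<delta> > 0" "\<And>t. \<lbrakk>0 < t; t < \<delta>\<rbrakk> \<Longrightarrow> 1 < (\<Prod>i\<in>UNIV. d t i)"
    by (auto simp: d_def)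
  have tend: "((\<lambda>t. d t i) \<longlongrightarrow> d 0 i) (at_right 0)" for i
    unfolding d_def by (intro tendsto_intros)
  have "\<forall>\<^sub>F t in at_right 0. \<forall>i. d t i > 0"
    by (intro eventually_all_finite order_tendstoD(1) [OF tend]) (simp add: d_def)
  moreover have "\<forall>\<^sub>F t in at_right 0. 0 < t \<and> 1 < (\<Prod>i\<in>UNIV. d t i)"
    using eventually_at_right_real [OF \<delta>(1)] by (rule eventually_mono) (use \<delta> in auto)
  \<comment> \<open>The first two properties hold for all small \<open>t\<close>, so failure of the
    conclusion means that the inclusion fails for each of them.\<close>
  ultimately have "\<forall>\<^sub>F t in at_right 0. 0 < t \<and> (\<exists>w\<in>ball 0 1. A *v (diagm (d t) *v w) \<notin> \<Omega>)"
  proof eventually_elim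
    case (elim t)
    then have "\<not> (*v) (A ** diagm (d t)) ` ball 0 1 \<subseteq> \<Omega>" using none that [of "d t"] by blast
    then show ?case using elim by (auto simp: matrix_vector_mul_assoc)
  qed
  then obtain \<epsilon> where \<epsilon>: "\<epsilon> > 0" and bad: "\<And>t. \<lbrakk>0 < t; t < \<epsilon>\<rbrakk> \<Longrightarrow> \<exists>w\<in>ball 0 1. A *v (diagm (d t) *v w) \<notin> \<Omega>"
    unfolding eventually_at_right_field by blast
  define s where "s k = \<epsilon> / (real k + 2)" for k
  have s: "0 < s k" "s k < \<epsilon>" for k using \<epsilon> by (simp_all add: s_def field_simps add_pos_nonneg)
  have "s = (\<lambda>k. \<epsilon> * inverse (real (k + 2)))" by (simp add: s_def divide_inverse fun_eq_iff)
  moreover have "(\<lambda>k. \<epsilon> * inverse (real (k + 2))) \<longlonglongrightarrow> \<epsilon> * 0"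
    by (intro tendsto_intros LIMSEQ_ignore_initial_segment [OF lim_inverse_n])
  ultimately have s0: "s \<longlonglongrightarrow> 0" by simp
  have "\<forall>k. \<exists>w. w \<in> ball 0 1 \<and> A *v (diagm (d (s k)) *v w) \<notin> \<Omega>" using bad s by blast
  then obtain w where w: "\<And>k. w k \<in> ball 0 1" "\<And>k. A *v (diagm (d (s k)) *v w k) \<notin> \<Omega>"
    by metis
  have "compact (cball (0 :: complex ^ 'n) 1)" "\<forall>k. w k \<in> cball 0 1"
    using w(1) by (auto simp: less_imp_le)
  then obtain w' r where w': "w' \<in> cball 0 1" and r: "strict_mono r" and lim: "(w \<circ> r) \<longlonglongrightarrow> w'"
    unfolding compact_def by blast
  have lim: "(\<lambda>k. w (r k)) \<longlonglongrightarrow> w'" using lim by (simp add: comp_def)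
  have sr: "(\<lambda>k. s (r k)) \<longlonglongrightarrow> 0"
    using LIMSEQ_subseq_LIMSEQ [OF s0 r] by (simp add: comp_def)
  have lim1: "(\<lambda>k. A *v w (r k)) \<longlonglongrightarrow> A *v w'"
    unfolding matrix_vector_mult_def by (intro tendsto_intros lim)
  have "(\<lambda>k. A *v (\<chi> i. of_real (d (s (r k)) i) * w (r k) $ i)) \<longlonglongrightarrow> A *v (\<chi> i. of_real (1 + 0 * e i) * w' $ i)"
    unfolding matrix_vector_mult_def d_def by (intro tendsto_intros lim sr)
  moreover have "diagm (d (s (r k))) *v w (r k) = (\<chi> i. of_real (d (s (r k)) i) * w (r k) $ i)" for k
    by (simp add: vec_eq_iff)
  ultimately have lim2: "(\<lambda>k. A *v (diagm (d (s (r k))) *v w (r k))) \<longlonglongrightarrow> A *v w'"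
    by simp
  have "A *v w k \<in> closure \<Omega>" for k
    using subsetD [OF A imageI [OF w(1)]] closure_subset by blast
  then have "A *v w' \<in> closure \<Omega>"
    by (intro Lim_in_closed_set [OF _ _ _ lim1] always_eventually) auto
  moreover have "A *v w' \<in> - \<Omega>"
    using \<Omega> w(2) by (intro Lim_in_closed_set [OF _ _ _ lim2]) auto
  ultimately have "A *v w' \<in> frontier \<Omega>" using \<Omega> by (simp add: frontier_def interior_open)
  moreover have "norm w' = 1"
  proof (rule ccontr)
    assume "norm w' \<noteq> 1"
    then have "w' \<in> ball 0 1" using w' by simp
    then show False using A \<open>A *v w' \<in> - \<Omega>\<close> by blast
  qed
  ultimately have q: "(\<Sum>i\<in>UNIV. e i * (cmod (w' $ i))\<^sup>2) < 0" by (intro neg)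
  \<comment> \<open>This is the change of the squared norm under the diagonal matrix, divided by
    \<open>t\<close>. Its limit is negative.\<close>
  have lim3: "(\<lambda>k. 2 * (\<Sum>i\<in>UNIV. e i * (cmod (w (r k) $ i))\<^sup>2) + s (r k) * (\<Sum>i\<in>UNIV. (e i)\<^sup>2 * (cmod (w (r k) $ i))\<^sup>2))
    \<longlonglongrightarrow> 2 * (\<Sum>i\<in>UNIV. e i * (cmod (w' $ i))\<^sup>2) + 0 * (\<Sum>i\<in>UNIV. (e i)\<^sup>2 * (cmod (w' $ i))\<^sup>2)"
    by (intro tendsto_intros lim sr)
  have "\<forall>\<^sub>F k in sequentially. 2 * (\<Sum>i\<in>UNIV. e i * (cmod (w (r k) $ i))\<^sup>2)
      + s (r k) * (\<Sum>i\<in>UNIV. (e i)\<^sup>2 * (cmod (w (r k) $ i))\<^sup>2) < 0"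
    by (rule order_tendstoD(2) [OF lim3]) (use q in simp)
  then obtain k where k: "2 * (\<Sum>i\<in>UNIV. e i * (cmod (w (r k) $ i))\<^sup>2)
      + s (r k) * (\<Sum>i\<in>UNIV. (e i)\<^sup>2 * (cmod (w (r k) $ i))\<^sup>2) < 0"
    using eventually_happens' [OF sequentially_bot] by blast
  let ?t = "s (r k)" and ?w = "w (r k)"
  have "(norm (diagm (d ?t) *v ?w))\<^sup>2 = (\<Sum>i\<in>UNIV. (d ?t i)\<^sup>2 * (cmod (?w $ i))\<^sup>2)"
    unfolding sq by (simp add: norm_mult power_mult_distrib)
  also have "\<dots> = (norm ?w)\<^sup>2 + ?t * (2 * (\<Sum>i\<in>UNIV. e i * (cmod (?w $ i))\<^sup>2) + ?t * (\<Sum>i\<in>UNIV. (e i)\<^sup>2 * (cmod (?w $ i))\<^sup>2))"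
    unfolding sq by (simp add: d_def sum_distrib_left distrib_left sum.distrib [symmetric] power2_eq_square algebra_simps)
  also have "\<dots> < (norm ?w)\<^sup>2"
    using k s(1) [of "r k"] by (simp add: mult_pos_neg)
  also have "\<dots> < 1" using w(1) [of "r k"] by (simp add: abs_square_less_1)
  finally have "diagm (d ?t) *v ?w \<in> ball 0 1" by (simp add: abs_square_less_1)
  then show False using A w(2) [of "r k"] by blast
qed

lemma max_volume_imp_measure:
  fixes \<Omega> :: "(complex ^ 'n) set" and M :: "complex ^ 'n ^ 'n"
  assumes \<Omega>: "open \<Omega>" and M: "invertible M" "(*v) M ` ball 0 1 \<subseteq> \<Omega>"
    and h: "\<And>v w. h (M *v v) (M *v w) = cdot v w"
    and max: "\<And>M' :: complex ^ 'n ^ 'n. \<lbrakk>invertible M'; (*v) M' ` ball 0 1 \<subseteq> \<Omega>\<rbrakk> \<Longrightarrow> cmod (det M') \<le> cmod (det M)"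
  shows "\<exists>\<mu>. sets \<mu> = sets (restrict_space borel (frontier \<Omega> \<inter> frontier ((*v) M ` ball 0 1))) \<and>
    (\<forall>T. clinear T \<longrightarrow> integrable \<mu> (\<lambda>z. h (T z) z) \<and> (LINT z|\<mu>. h (T z) z) = ctrace T)"
proof -
  let ?K = "{z. norm z = 1 \<and> M *v z \<in> frontier \<Omega>}"
  \<comment> \<open>\<open>outer z\<close> has trace 1 for unit vectors \<open>z\<close>, so this is
    the multiple of the identity to be found in the convex hull. The hull replaces the cone because
    it is compact.\<close>
  let ?I = "(1 / real CARD('n)) *\<^sub>R mat 1 :: complex ^ 'n ^ 'n"
  have "?K = sphere 0 1 \<inter> (*v) M -` frontier \<Omega>" by auto
  moreover have "closed ((*v) M -` frontier \<Omega>)"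
    using linear_continuous_on [OF bounded_linear_matrix] by (intro closed_vimage frontier_closed)
  ultimately have "compact ?K" by (simp add: compact_Int_closed)
  moreover have "continuous_on ?K outer"
    unfolding outer_def by (intro continuous_intros)
  ultimately have cpt: "compact (convex hull (outer ` ?K))"
    by (intro compact_convex_hull compact_continuous_image)
  have "?I \<in> convex hull (outer ` ?K)"
  proof (rule ccontr)
    assume "?I \<notin> convex hull (outer ` ?K)"
    then obtain a b where a: "inner a ?I < b" and b: "\<And>x. x \<in> convex hull (outer ` ?K) \<Longrightarrow> b < inner a x"
      using separating_hyperplane_closed_point [OF convex_convex_hull compact_imp_closed [OF cpt]] by blast
    \<comment> \<open>\<open>b\<close> times the identity minus the hermitian part of
      \<open>a\<close>. Its form at a unit vector is \<open>b - inner a (outer z)\<close>, negative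
      at contact points, and its trace is \<open>CARD('n)\<close> times
      \<open>b - inner a ?I\<close>, which is positive.\<close>
    define H where "H = diagm (\<lambda>i. b) - (1/2) *\<^sub>R (a + adjm a)"
    have "adjm H = H"
      by (simp add: H_def adjm_def diagm_def vec_eq_iff add.commute)
    then obtain U e where U: "unitary U" and H: "H = U ** diagm e ** adjm U"
      by (rule hermitian_diagonalization)
    have form: "Re (cdot (H *v z) z) = b * (norm z)\<^sup>2 - inner a (outer z)" for z
    proof -
      have "H *v z = of_real b *s z - of_real (1/2) *s (a *v z + adjm a *v z)"
        by (simp add: H_def vec_eq_iff matrix_vector_mult_def diagm_def)
           (simp add: scaleR_conv_of_real algebra_simps sum.distrib sum_subtractf sum_distrib_left sum_divide_distrib
              if_distrib [of "\<lambda>x. _ * x"] cong: if_cong)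
      then have "cdot (H *v z) z = of_real b * cdot z z - of_real (1/2) * (cdot (a *v z) z + cdot (adjm a *v z) z)"
        by (simp only: cdot_simps)
      moreover have "cdot (a *v z) z = cnj (cdot (adjm a *v z) z)"
        by (simp add: cdot_adjm [of a] cdot_commute)
      ultimately show ?thesis by (simp add: inner_outer cdot_self del: of_real_power)
    qed
    \<comment> \<open>Coordinates in which \<open>H\<close> is diagonal; the unitary factor leaves
      the ellipsoid unchanged.\<close>
    define A where "A = M ** U"
    have "(\<Sum>i\<in>UNIV. e i) > 0"
    proof -
      have "of_real (\<Sum>i\<in>UNIV. e i) = trace H"
        using U unfolding H trace_conjugate [of "adjm U" U, OF U [unfolded unitary_def]] by (simp add: trace_diagm)
      then have "(\<Sum>i\<in>UNIV. e i) = Re (trace H)" by (metis Re_complex_of_real)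
      also have "\<dots> = real CARD('n) * (b - inner a ?I)"
        by (simp add: trace_def H_def diagm_def adjm_def sum_subtractf inner_vec_def mat_def inner_complex_def
            if_distrib [of Re] if_distrib [of Im] if_distrib [of "\<lambda>x. _ * x"] algebra_simps sum_divide_distrib [symmetric] cong: if_cong)
      also have "\<dots> > 0" using a by simp
      finally show ?thesis .
    qed
    moreover have "(\<Sum>i\<in>UNIV. e i * (cmod (w $ i))\<^sup>2) < 0" if w: "norm w = 1" "A *v w \<in> frontier \<Omega>" for w
    proof -
      have "U *v w \<in> ?K"
        using w by (simp add: norm_unitary [OF U] A_def matrix_vector_mul_assoc)
      then have "b < inner a (outer (U *v w))" by (intro b hull_inc) blast
      then have "Re (cdot (H *v (U *v w)) (U *v w)) < 0"
        using w by (simp add: form norm_unitary [OF U])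
      moreover have "H *v (U *v w) = U *v (diagm e *v ((adjm U ** U) *v w))"
        by (simp add: H matrix_vector_mul_assoc matrix_mul_assoc)
      then have "cdot (H *v (U *v w)) (U *v w) = cdot (diagm e *v w) w"
        using U by (simp add: cdot_unitary [OF U] unitary_def)
      ultimately show ?thesis by (simp add: cdot_diagm)
    qed
    moreover have A: "(*v) A ` ball 0 1 \<subseteq> \<Omega>"
    proof -
      have "(*v) A ` ball 0 1 = (*v) M ` (*v) U ` ball 0 1"
        by (simp add: A_def image_image matrix_vector_mul_assoc)
      then show ?thesis using M(2) by (simp only: unitary_ball [OF U])
    qed
    ultimately obtain d where d: "\<And>i. d i > 0" "1 < (\<Prod>i\<in>UNIV. d i)" "(*v) (A ** diagm d) ` ball 0 1 \<subseteq> \<Omega>"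
      using enlarged_ellipsoid [OF \<Omega> A] by blast
    have "invertible (A ** diagm d)"
      unfolding A_def using d(1) by (intro invertible_mult M invertible_unitary U invertible_diagm) (metis less_irrefl)
    then have "cmod (det (A ** diagm d)) \<le> cmod (det M)" using d(3) by (rule max)
    moreover have "cmod (det (A ** diagm d)) = cmod (det M) * (\<Prod>i\<in>UNIV. d i)"
      using d(1) by (simp add: A_def det_mul norm_mult cmod_det_unitary U det_diagm abs_of_pos flip: prod_norm)
    moreover have "cmod (det M) > 0" using M by (simp add: invertible_det_nz)
    ultimately show False using d(2) by (simp add: mult_le_cancel_left2)
  qed
  then obtain S u where S: "finite S" "S \<subseteq> outer ` ?K" "\<forall>x\<in>S. 0 \<le> u x" "(\<Sum>v\<in>S. u v *\<^sub>R v) = ?I"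
    unfolding convex_hull_explicit by blast
  \<comment> \<open>Selects for each matrix in \<open>S\<close> a contact point that produces
    it.\<close>
  define \<zeta> where "\<zeta> = inv_into ?K outer"
  have \<zeta>: "\<zeta> v \<in> ?K" "outer (\<zeta> v) = v" if "v \<in> S" for v
    using S(2) that unfolding \<zeta>_def by (auto intro!: inv_into_into f_inv_into_f simp del: mem_Collect_eq)
  \<comment> \<open>The convex weights are multiplied by the dimension to obtain the identity
    itself.\<close>
  show ?thesis
  proof (rule measure_from_trace_identity [OF M(1) h S(1)])
    show "M *v \<zeta> v \<in> frontier \<Omega> \<inter> frontier ((*v) M ` ball 0 1)" if "v \<in> S" for v
      using \<zeta>(1) [OF that] by (simp add: frontier_matrix_ball [OF M(1)])
    show "outer (\<zeta> v) = v" if "v \<in> S" for v using \<zeta>(2) [OF that] .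
    show "0 \<le> real CARD('n) * u v" if "v \<in> S" for v using S(3) that by simp
    show "(\<Sum>v\<in>S. (real CARD('n) * u v) *\<^sub>R v) = mat 1"
      using arg_cong [OF S(4), of "(*\<^sub>R) (real CARD('n))"] by (simp add: scaleR_sum_right)
  qed
qed

theorem theorem1p1:
  fixes \<Omega> :: "(complex ^ 'n) set"
  assumes "open \<Omega>" and "connected \<Omega>" and "bounded \<Omega>" and "pseudoconvex \<Omega>" and "0 \<in> \<Omega>"
  shows "(\<exists>E. max_volume_ellipsoid \<Omega> E) \<and>
    (\<forall>h. pos_def_hermitian_form h \<longrightarrow> ellipsoid_of h \<subseteq> \<Omega> \<longrightarrow>
      (max_volume_ellipsoid \<Omega> (ellipsoid_of h) \<longleftrightarrow>
       (\<exists>\<mu> :: (complex ^ 'n) measure.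
          sets \<mu> = sets (restrict_space borel (frontier \<Omega> \<inter> frontier (ellipsoid_of h))) \<and>
          (\<forall>T. clinear T \<longrightarrow>
             integrable \<mu> (\<lambda>z. h (T z) z) \<and>
             (LINT z|\<mu>. h (T z) z) = ctrace T))))"
proof (intro conjI allI impI)
  show "\<exists>E. max_volume_ellipsoid \<Omega> E"
    using assms by (intro exists_max_volume_ellipsoid)
next
  fix h :: "complex ^ 'n \<Rightarrow> complex ^ 'n \<Rightarrow> complex"
  assume "pos_def_hermitian_form h" and sub: "ellipsoid_of h \<subseteq> \<Omega>"
  then obtain M :: "complex ^ 'n ^ 'n" where M: "invertible M" and h: "\<And>v w. h (M *v v) (M *v w) = cdot v w"
    using pos_def_form_matrix by blast
  have E: "ellipsoid_of h = (*v) M ` ball 0 1" by (rule ellipsoid_of_matrix [OF M h])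
  have sub: "(*v) M ` ball 0 1 \<subseteq> \<Omega>" using sub by (simp only: E)
  show "max_volume_ellipsoid \<Omega> (ellipsoid_of h) \<longleftrightarrow>
       (\<exists>\<mu> :: (complex ^ 'n) measure.
          sets \<mu> = sets (restrict_space borel (frontier \<Omega> \<inter> frontier (ellipsoid_of h))) \<and>
          (\<forall>T. clinear T \<longrightarrow>
             integrable \<mu> (\<lambda>z. h (T z) z) \<and>
             (LINT z|\<mu>. h (T z) z) = ctrace T))"
    unfolding E max_volume_ellipsoid_matrix [OF M sub]
  proof (intro iffI allI impI)
    assume max: "\<forall>M' :: complex ^ 'n ^ 'n. invertible M' \<longrightarrow> (*v) M' ` ball 0 1 \<subseteq> \<Omega> \<longrightarrow> cmod (det M') \<le> cmod (det M)"
    show "\<exists>\<mu>. sets \<mu> = sets (restrict_space borel (frontier \<Omega> \<inter> frontier ((*v) M ` ball 0 1))) \<and>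
        (\<forall>T. clinear T \<longrightarrow> integrable \<mu> (\<lambda>z. h (T z) z) \<and> (LINT z|\<mu>. h (T z) z) = ctrace T)"
      by (rule max_volume_imp_measure [OF assms(1) M sub h]) (use max in blast)
  next
    fix M' :: "complex ^ 'n ^ 'n"
    assume "\<exists>\<mu>. sets \<mu> = sets (restrict_space borel (frontier \<Omega> \<inter> frontier ((*v) M ` ball 0 1))) \<and>
        (\<forall>T. clinear T \<longrightarrow> integrable \<mu> (\<lambda>z. h (T z) z) \<and> (LINT z|\<mu>. h (T z) z) = ctrace T)"
      and M': "invertible M'" "(*v) M' ` ball 0 1 \<subseteq> \<Omega>"
    then obtain \<mu> where \<mu>: "sets \<mu> = sets (restrict_space borel (frontier \<Omega> \<inter> frontier ((*v) M ` ball 0 1)))"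
      "\<forall>T. clinear T \<longrightarrow> integrable \<mu> (\<lambda>z. h (T z) z) \<and> (LINT z|\<mu>. h (T z) z) = ctrace T"
      by blast
    show "cmod (det M') \<le> cmod (det M)"
      by (rule measure_imp_max_volume [OF assms(4) M sub h \<mu>(1) _ M']) (use \<mu>(2) in blast)
  qed
qed

end
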